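(* Let $\bar V_2\le \bar W_2:\mathcal X\times\mathcal X\to[1,\infty)$ be symmetric measurable functions such that $P$ satisfies $C(2,\bar V_2,\bar W_2)$, and such that $P^s\bar W_2(x,y)<\infty$ for all $(x,y)\in\mathcal X^2$ and $s\in\{1,2\}$. Let $h:\mathcal X\times\mathcal X\to\mathbb R$ be a symmetric measurable function with $\int\int|h(x,y)|\mu(dx)\mu(dy)<\infty$, and let $\bar h_2$ and $\bar G_2$ be associated with $h$ as in the context. Suppose that $\bar h_2\in\mathcal L_{\bar V_2}$. Then $\bar G_2$ is well-defined, $\bar G_2\in\mathcal L_{\bar W_2}$, $|\bar G_2|_{\bar W_2}\le c|\bar h_2|_{\bar V_2}$, and for all $x,y\in\mathcal X$, $$\bar h_2(x,y)=\int\big(\delta_x(dz_1)-P(x,dz_1)\big)\int\big(\delta_y(dz_2)-P(y,dz_2)\big)\bar G_2(z_1,z_2).$$ If in addition $P^s\bar h_2\in\mathcal L_{\bar V_2}$, then $|P^s\bar G_2|_{\bar W_2}\le c|P^s\bar h_2|_{\bar V_2}$, for $s\in\{1,2\}$. Here $c$ is a finite constant that does not depend on $h$.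
   Context: $(\mathcal X,\mathcal B)$ is a measurable space with countably generated sigma-algebra, $P$ is a Markov transition kernel on it with invariant probability distribution $\mu$. $P^0$ is the identity kernel and $P^n$ ($n\ge1$) is the $n$-th iterate of $P$. $\delta_x$ is the Dirac measure at $x$. For a function $W:\mathbb T\to[1,\infty)$ and $f:\mathbb T\to\mathbb R$ measurable, $|f|_W:=\sup_{x\in\mathbb T}|f(x)|/W(x)$, and $\mathcal L_W$ is the set of measurable $f$ with $|f|_W<\infty$. For a finite signed measure $\nu$ on $\mathbb T$, $\|\nu\|_W:=\int W\,d|\nu|$, with $|\nu|$ the total variation measure. For a bivariate function $h$: $Ph(x,y):=\int P(x,dz)h(z,y)$ (kernel acting on the first coordinate) and $P^2h(x_1,x_2):=\int P(x_1,dz_1)\int P(x_2,dz_2)h(z_1,z_2)$ (kernel acting on both coordinates). Condition $C(2,\bar V_2,\bar W_2)$: there is a finite constant $c$ such that for all $(x_1,x_2)\in\mathcal X^2$, $$\sum_{\ell_1\ge0}\sum_{\ell_2\ge0}\Big\|\big(P^{\ell_1}(x_1,\cdot)-\mu\big)\otimes\big(P^{\ell_2}(x_2,\cdot)-\mu\big)\Big\|_{\bar V_2}\le c\,\bar W_2(x_1,x_2).$$ Under this condition, $\bar R_2(x,y;(du,dv)):=\sum_{n_1\ge0}\sum_{n_2\ge0}(P^{n_1}(x,du)-\mu(du))\otimes(P^{n_2}(y,dv)-\mu(dv))$ is a finite signed measure on $\mathcal X\times\mathcal X$ with finite $\|\cdot\|_{\bar V_2}$-norm. For $h$ symmetric and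 integrable with respect to $\mu\otimes\mu$: $\theta:=\int\int h(x,y)\mu(dx)\mu(dy)$, $\bar h_1(x):=\int h(x,z)\mu(dz)-\theta$, $\bar h_2(x,y):=h(x,y)-\bar h_1(x)-\bar h_1(y)-\theta$, and $\bar G_2(x,y):=\int\int\bar R_2(x,y;dz_1,dz_2)\bar h_2(z_1,z_2)$. Convention: $c$ denotes a finite constant depending solely on $P$ (with the functions $\bar V_2,\bar W_2$ attached to $P$ regarded as fixed), whose value may change from one inequality to the next. *)

theory Defs
  imports "HOL-Probability.Probability"
begin

definition countably_generated :: "'a measure \<Rightarrow> bool" where
  "countably_generated M \<longleftrightarrow>
     (\<exists>E. countable E \<and> E \<subseteq> Pow (space M) \<and> sets M = sigma_sets (space M) E)"


subsection \<open>Finite signed measures\<close>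

text \<open>
  The libraries have no signed measures. A finite signed measure on \<open>M\<close> is a real-valued set
  function \<open>\<nu>\<close> of which only the values on \<open>sets M\<close> matter; countable additivity
  implies \<open>\<nu> {} = 0\<close> (take the constant sequence of empty sets).
\<close>

definition finite_signed_measure :: "'a measure \<Rightarrow> ('a set \<Rightarrow> real) \<Rightarrow> bool" where
  "finite_signed_measure M \<nu> \<longleftrightarrow>
     (\<forall>A :: nat \<Rightarrow> 'a set. range A \<subseteq> sets M \<longrightarrow> disjoint_family A \<longrightarrow>
        (\<lambda>i. \<nu> (A i)) sums \<nu> (\<Union>i. A i))"

text \<open>
  Jordan decomposition: the positive part is \<open>A \<mapsto> sup {\<nu> B | B \<subseteq> A}\<close>. Clipping negative
  values by \<open>ennreal\<close> is harmless because \<open>B = {}\<close> contributes \<open>0\<close>.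
  These are meaningful only if \<open>\<nu>\<close> is a finite signed measure: otherwise
  \<^const>\<open>measure_of\<close> may yield the zero measure.
\<close>

definition pos_part :: "'a measure \<Rightarrow> ('a set \<Rightarrow> real) \<Rightarrow> 'a measure" where
  "pos_part M \<nu> =
     measure_of (space M) (sets M) (\<lambda>A. SUP B\<in>{B \<in> sets M. B \<subseteq> A}. ennreal (\<nu> B))"

definition neg_part :: "'a measure \<Rightarrow> ('a set \<Rightarrow> real) \<Rightarrow> 'a measure" where
  "neg_part M \<nu> = pos_part M (\<lambda>A. - \<nu> A)"

definition total_variation :: "'a measure \<Rightarrow> ('a set \<Rightarrow> real) \<Rightarrow> 'a measure" where
  "total_variation M \<nu> =
     measure_of (space M) (sets M) (\<lambda>A. emeasure (pos_part M \<nu>) A + emeasure (neg_part M \<nu>) A)"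

definition signed_integrable :: "'a measure \<Rightarrow> ('a set \<Rightarrow> real) \<Rightarrow> ('a \<Rightarrow> real) \<Rightarrow> bool" where
  "signed_integrable M \<nu> f \<longleftrightarrow> integrable (total_variation M \<nu>) f"

definition signed_integral :: "'a measure \<Rightarrow> ('a set \<Rightarrow> real) \<Rightarrow> ('a \<Rightarrow> real) \<Rightarrow> real" where
  "signed_integral M \<nu> f = (\<integral>x. f x \<partial>pos_part M \<nu>) - (\<integral>x. f x \<partial>neg_part M \<nu>)"

text \<open>The difference of two finite measures, as a signed measure.\<close>

definition measure_diff :: "'a measure \<Rightarrow> 'a measure \<Rightarrow> 'a set \<Rightarrow> real" where
  "measure_diff \<mu> \<nu> A = measure \<mu> A - measure \<nu> A"

text \<open>The product of signed measures, obtained bilinearly from their Jordan decompositions.\<close>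

definition signed_pair ::
    "'a measure \<Rightarrow> ('a set \<Rightarrow> real) \<Rightarrow> 'b measure \<Rightarrow> ('b set \<Rightarrow> real) \<Rightarrow> ('a \<times> 'b) set \<Rightarrow> real" where
  "signed_pair M \<nu> N \<kappa> E =
     measure (pos_part M \<nu> \<Otimes>\<^sub>M pos_part N \<kappa>) E - measure (pos_part M \<nu> \<Otimes>\<^sub>M neg_part N \<kappa>) E
   - measure (neg_part M \<nu> \<Otimes>\<^sub>M pos_part N \<kappa>) E + measure (neg_part M \<nu> \<Otimes>\<^sub>M neg_part N \<kappa>) E"


subsection \<open>Weighted norms\<close>

definition weighted_norm :: "'a measure \<Rightarrow> ('a \<Rightarrow> real) \<Rightarrow> ('a \<Rightarrow> real) \<Rightarrow> ennreal" where
  "weighted_norm N W f = (SUP x\<in>space N. ennreal (\<bar>f x\<bar> / W x))"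

definition weighted_space :: "'a measure \<Rightarrow> ('a \<Rightarrow> real) \<Rightarrow> ('a \<Rightarrow> real) set" where
  "weighted_space N W = {f \<in> borel_measurable N. weighted_norm N W f < \<infinity>}"

definition signed_norm :: "'a measure \<Rightarrow> ('a \<Rightarrow> real) \<Rightarrow> ('a set \<Rightarrow> real) \<Rightarrow> ennreal" where
  "signed_norm N W \<nu> = (\<integral>\<^sup>+x. ennreal (W x) \<partial>total_variation N \<nu>)"


subsection \<open>Markov kernels\<close>

text \<open>
  Markov kernels on \<open>M\<close> are the measurable maps from \<open>M\<close> to \<^term>\<open>prob_algebra M\<close>.
\<close>

primrec kernel_power :: "'a measure \<Rightarrow> ('a \<Rightarrow> 'a measure) \<Rightarrow> nat \<Rightarrow> 'a \<Rightarrow> 'a measure" where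
  "kernel_power M P 0 = return M"
| "kernel_power M P (Suc n) = (\<lambda>x. kernel_power M P n x \<bind> P)"

definition invariant_distribution :: "'a measure \<Rightarrow> ('a \<Rightarrow> 'a measure) \<Rightarrow> 'a measure \<Rightarrow> bool" where
  "invariant_distribution M P \<mu> \<longleftrightarrow> \<mu> \<in> space (prob_algebra M) \<and> \<mu> \<bind> P = \<mu>"

text \<open>
  The actions on bivariate functions of \<open>P\<close> (first coordinate only) and of \<open>P\<^sup>2\<close> (both
  coordinates; not the second iterate). The versions with suffix \<open>nn\<close> are for nonnegative
  functions whose integrals may be infinite.
\<close>

definition act1 :: "('a \<Rightarrow> 'a measure) \<Rightarrow> ('a \<times> 'a \<Rightarrow> real) \<Rightarrow> 'a \<times> 'a \<Rightarrow> real" where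
  "act1 P h = (\<lambda>(x, y). \<integral>z. h (z, y) \<partial>P x)"

definition act2 :: "('a \<Rightarrow> 'a measure) \<Rightarrow> ('a \<times> 'a \<Rightarrow> real) \<Rightarrow> 'a \<times> 'a \<Rightarrow> real" where
  "act2 P h = (\<lambda>(x\<^sub>1, x\<^sub>2). \<integral>z\<^sub>1. (\<integral>z\<^sub>2. h (z\<^sub>1, z\<^sub>2) \<partial>P x\<^sub>2) \<partial>P x\<^sub>1)"

definition act1_nn :: "('a \<Rightarrow> 'a measure) \<Rightarrow> ('a \<times> 'a \<Rightarrow> real) \<Rightarrow> 'a \<times> 'a \<Rightarrow> ennreal" where
  "act1_nn P W = (\<lambda>(x, y). \<integral>\<^sup>+z. ennreal (W (z, y)) \<partial>P x)"

definition act2_nn :: "('a \<Rightarrow> 'a measure) \<Rightarrow> ('a \<times> 'a \<Rightarrow> real) \<Rightarrow> 'a \<times> 'a \<Rightarrow> ennreal" where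
  "act2_nn P W = (\<lambda>(x\<^sub>1, x\<^sub>2). \<integral>\<^sup>+z\<^sub>1. (\<integral>\<^sup>+z\<^sub>2. ennreal (W (z\<^sub>1, z\<^sub>2)) \<partial>P x\<^sub>2) \<partial>P x\<^sub>1)"

text \<open>
  \<open>(P\<^sup>n\<^sup>1(x, \<cdot>) - \<mu>) \<otimes> (P\<^sup>n\<^sup>2(y, \<cdot>) - \<mu>)\<close>, the summand of condition C and of the
  bivariate resolvent.
\<close>

definition centered_pair ::
    "'a measure \<Rightarrow> ('a \<Rightarrow> 'a measure) \<Rightarrow> 'a measure \<Rightarrow> nat \<Rightarrow> nat \<Rightarrow> 'a \<Rightarrow> 'a \<Rightarrow> ('a \<times> 'a) set \<Rightarrow> real" where
  "centered_pair M P \<mu> n\<^sub>1 n\<^sub>2 x y =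
     signed_pair M (measure_diff (kernel_power M P n\<^sub>1 x) \<mu>) M (measure_diff (kernel_power M P n\<^sub>2 y) \<mu>)"

definition condition_C2 ::
    "'a measure \<Rightarrow> ('a \<Rightarrow> 'a measure) \<Rightarrow> 'a measure \<Rightarrow> ('a \<times> 'a \<Rightarrow> real) \<Rightarrow> ('a \<times> 'a \<Rightarrow> real) \<Rightarrow> bool" where
  "condition_C2 M P \<mu> V W \<longleftrightarrow>
     (\<exists>c::real. \<forall>x\<^sub>1\<in>space M. \<forall>x\<^sub>2\<in>space M.
        (\<Sum>l\<^sub>1. \<Sum>l\<^sub>2. signed_norm (M \<Otimes>\<^sub>M M) V (centered_pair M P \<mu> l\<^sub>1 l\<^sub>2 x\<^sub>1 x\<^sub>2))
          \<le> ennreal (c * W (x\<^sub>1, x\<^sub>2)))"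

definition resolvent2 ::
    "'a measure \<Rightarrow> ('a \<Rightarrow> 'a measure) \<Rightarrow> 'a measure \<Rightarrow> 'a \<Rightarrow> 'a \<Rightarrow> ('a \<times> 'a) set \<Rightarrow> real" where
  "resolvent2 M P \<mu> x y E = (\<Sum>n\<^sub>1. \<Sum>n\<^sub>2. centered_pair M P \<mu> n\<^sub>1 n\<^sub>2 x y E)"


subsection \<open>Hoeffding projections and the bivariate Poisson solution\<close>

definition theta :: "'a measure \<Rightarrow> ('a \<times> 'a \<Rightarrow> real) \<Rightarrow> real" where
  "theta \<mu> h = (\<integral>x. (\<integral>y. h (x, y) \<partial>\<mu>) \<partial>\<mu>)"

definition hbar1 :: "'a measure \<Rightarrow> ('a \<times> 'a \<Rightarrow> real) \<Rightarrow> 'a \<Rightarrow> real" where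
  "hbar1 \<mu> h x = (\<integral>z. h (x, z) \<partial>\<mu>) - theta \<mu> h"

definition hbar2 :: "'a measure \<Rightarrow> ('a \<times> 'a \<Rightarrow> real) \<Rightarrow> 'a \<times> 'a \<Rightarrow> real" where
  "hbar2 \<mu> h = (\<lambda>(x, y). h (x, y) - hbar1 \<mu> h x - hbar1 \<mu> h y - theta \<mu> h)"

definition Gbar2 ::
    "'a measure \<Rightarrow> ('a \<Rightarrow> 'a measure) \<Rightarrow> 'a measure \<Rightarrow> ('a \<times> 'a \<Rightarrow> real) \<Rightarrow> 'a \<times> 'a \<Rightarrow> real" where
  "Gbar2 M P \<mu> h = (\<lambda>(x, y). signed_integral (M \<Otimes>\<^sub>M M) (resolvent2 M P \<mu> x y) (hbar2 \<mu> h))"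

text \<open>
  What it means for \<^const>\<open>Gbar2\<close> to be given by an actual integral at every point: the series
  defining the resolvent converges (unconditionally, on every measurable set) to a finite signed
  measure that integrates \<^term>\<open>hbar2 \<mu> h\<close>.
\<close>

definition Gbar2_well_defined ::
    "'a measure \<Rightarrow> ('a \<Rightarrow> 'a measure) \<Rightarrow> 'a measure \<Rightarrow> ('a \<times> 'a \<Rightarrow> real) \<Rightarrow> bool" where
  "Gbar2_well_defined M P \<mu> h \<longleftrightarrow>
     (\<forall>x\<in>space M. \<forall>y\<in>space M.
        (\<forall>E\<in>sets (M \<Otimes>\<^sub>M M). (\<lambda>(n\<^sub>1, n\<^sub>2). centered_pair M P \<mu> n\<^sub>1 n\<^sub>2 x y E) summable_on UNIV) \<and>
        finite_signed_measure (M \<Otimes>\<^sub>M M) (resolvent2 M P \<mu> x y) \<and>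
        signed_integrable (M \<Otimes>\<^sub>M M) (resolvent2 M P \<mu> x y) (hbar2 \<mu> h))"

end

theory Submission
  imports Defs
begin

text \<open>
  Write the centred pairs as \<open>p - n\<close> by Hahn's theorem. Condition C makes the sums of all
  \<open>p\<close> and of all \<open>n\<close> finite measures that integrate \<open>V\<close>, so the resolvent is
  their difference and \<open>G g = (\<Sum>k l. F k l g)\<close>, with \<open>F k l g\<close> the integral of \<open>g\<close> against
  \<open>(P\<^sup>k - \<mu>) \<otimes> (P\<^sup>l - \<mu>)\<close> and the sum of absolute values at most \<open>c |g| W\<close>. Acting with \<open>P\<close> on a
  coordinate commutes with the sum, as \<open>W\<close> dominates, and shifts the corresponding index. Hence
  the bounds for \<open>P G\<close> follow from those for \<open>G\<close>, and the Poisson equation telescopes to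
  \<open>F 0 0 g = g\<close> for degenerate \<open>g\<close>.
  The exchange of integrals needs \<open>V\<close> to be integrable under the uncentred products of
  \<open>P\<^sup>k\<close> and \<open>\<mu>\<close>, which has to be extracted from condition C.
\<close>

subsection \<open>Sums of measures\<close>

text \<open>Condition C bounds a total variation, so whatever \<open>P^k(x, .)\<close> and \<mu>
  have in common cancels before \<open>V\<close> is integrated, and finiteness of \<open>V\<close>
  under each of them separately does not follow from the triangle inequality. Only at time 0 is the
  cancellation under control: the positive part of a Dirac measure minus \<mu> charges every
  measurable set that contains the point and has \<mu>-measure below 1. This forces finiteness at
  that point, and then under \<mu>. The other obstacle is that norms and products of signed measures
  are given through Jordan parts, which are not additive, whereas kernels act bilinearly. Identities
  between the two are therefore kept as equalities of sums of measures,
  \<open>p + b = n + a\<close>, which survive integration and products, and are solved for a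
  difference only once everything is finite. Working with the series \<open>G\<close> instead of the
  resolvent lets \<open>P\<close> act on functions only: no kernel is ever applied to a signed
  measure.\<close>

definition sum_measure :: "'a measure \<Rightarrow> (nat \<Rightarrow> 'a measure) \<Rightarrow> 'a measure" where
  "sum_measure M N = measure_of (space M) (sets M) (\<lambda>A. \<Sum>i. emeasure (N i) A)"

lemma
  shows space_sum_measure[simp]: "space (sum_measure M N) = space M"
    and sets_sum_measure[simp, measurable_cong]: "sets (sum_measure M N) = sets M"
  by (auto simp: sum_measure_def)

lemma suminf_swap_ennreal:
  fixes f :: "nat \<Rightarrow> nat \<Rightarrow> ennreal"
  shows "(\<Sum>i. \<Sum>j. f i j) = (\<Sum>j. \<Sum>i. f i j)"
proof -
  have "(\<Sum>i. \<Sum>j. f i j) = (\<integral>\<^sup>+i. (\<Sum>j. f i j) \<partial>count_space UNIV)"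
    by (rule nn_integral_count_space_nat[symmetric])
  also have "\<dots> = (\<Sum>j. \<integral>\<^sup>+i. f i j \<partial>count_space UNIV)"
    by (rule nn_integral_suminf) simp
  finally show ?thesis by (simp add: nn_integral_count_space_nat)
qed

lemma emeasure_sum_measure:
  assumes sets: "\<And>i. sets (N i) = sets M" and A: "A \<in> sets M"
  shows "emeasure (sum_measure M N) A = (\<Sum>i. emeasure (N i) A)"
  unfolding sum_measure_def
proof (rule emeasure_measure_of_sigma)
  show "sigma_algebra (space M) (sets M)" ..
  show "positive (sets M) (\<lambda>A. \<Sum>i. emeasure (N i) A)"
    by (simp add: positive_def)
  show "countably_additive (sets M) (\<lambda>A. \<Sum>i. emeasure (N i) A)"
  proof (rule countably_additiveI)
    fix A :: "nat \<Rightarrow> _" assume A: "range A \<subseteq> sets M" "disjoint_family A"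
    have "(\<Sum>j. \<Sum>i. emeasure (N i) (A j)) = (\<Sum>i. \<Sum>j. emeasure (N i) (A j))"
      by (rule suminf_swap_ennreal)
    also have "\<dots> = (\<Sum>i. emeasure (N i) (\<Union>j. A j))"
      using A sets by (simp add: suminf_emeasure)
    finally show "(\<Sum>j. \<Sum>i. emeasure (N i) (A j)) = (\<Sum>i. emeasure (N i) (\<Union>j. A j))" .
  qed
qed fact

lemma nn_integral_sum_measure:
  assumes sets: "\<And>i. sets (N i) = sets M" and f: "f \<in> borel_measurable M"
  shows "(\<integral>\<^sup>+x. f x \<partial>sum_measure M N) = (\<Sum>i. \<integral>\<^sup>+x. f x \<partial>N i)"
  using f
proof induction
  \<comment> \<open>The two functions agree on \<open>space M\<close> only, which is the space of
    every measure involved.\<close>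
  case (cong f g)
  have "(\<integral>\<^sup>+x. f x \<partial>K) = (\<integral>\<^sup>+x. g x \<partial>K)" if "sets K = sets M" for K
    using cong(3) sets_eq_imp_space_eq[OF that] by (intro nn_integral_cong) auto
  with sets cong(4) show ?case by simp
next
  case (set A)
  then show ?case using sets by (simp add: emeasure_sum_measure)
next
  case (mult u c)
  have [measurable]: "u \<in> borel_measurable (N i)" for i
    using mult(2) sets by (simp cong: measurable_cong_sets)
  have [measurable]: "u \<in> borel_measurable (sum_measure M N)"
    using mult(2) by (simp cong: measurable_cong_sets)
  show ?case by (simp add: nn_integral_cmult mult)
next
  case (add u v)
  have [measurable]: "u \<in> borel_measurable (N i)" "v \<in> borel_measurable (N i)" for i
    using add sets by (simp_all cong: measurable_cong_sets)
  have [measurable]: "u \<in> borel_measurable (sum_measure M N)" "v \<in> borel_measurable (sum_measure M N)"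
    using add by (simp_all cong: measurable_cong_sets)
  show ?case by (simp add: nn_integral_add add suminf_add[symmetric])
next
  case (seq U)
  have [measurable]: "U j \<in> borel_measurable (N i)" for i j
    using seq sets by (simp cong: measurable_cong_sets)
  have [measurable]: "U j \<in> borel_measurable (sum_measure M N)" for j
    using seq by (simp cong: measurable_cong_sets)
  have "(\<integral>\<^sup>+x. (SUP j. U j) x \<partial>sum_measure M N) = (SUP j. \<Sum>i. \<integral>\<^sup>+x. U j x \<partial>N i)"
    using seq by (simp add: nn_integral_monotone_convergence_SUP image_comp)
  also have "\<dots> = (\<Sum>i. SUP j. \<integral>\<^sup>+x. U j x \<partial>N i)"
  \<comment> \<open>The supremum passes through the series because monotonicity of \<open>U\<close>
    makes the integrals directed: \<open>max i j\<close> serves all summands at once.\<close>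
  proof (rule ennreal_suminf_SUP_eq_directed[symmetric])
    fix F :: "nat set" and i j
    show "\<exists>k\<in>UNIV. \<forall>n\<in>F. integral\<^sup>N (N n) (U i) \<le> integral\<^sup>N (N n) (U k) \<and>
        integral\<^sup>N (N n) (U j) \<le> integral\<^sup>N (N n) (U k)"
      using \<open>incseq U\<close> by (intro bexI[of _ "max i j"] ballI conjI nn_integral_mono le_funD[OF incseqD[of U]])
        auto
  qed
  also have "\<dots> = (\<Sum>i. \<integral>\<^sup>+x. (SUP j. U j) x \<partial>N i)"
    using seq by (simp add: nn_integral_monotone_convergence_SUP image_comp)
  finally show ?case .
qed

lemma sums_enn2real:
  assumes "suminf u < (\<infinity>::ennreal)"
  shows "(\<lambda>i. enn2real (u i)) sums enn2real (suminf u)"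
proof -
  have "u i < \<infinity>" for i
    using assms ennreal_suminf_lessD[of u \<infinity> i] by simp
  then have "(\<lambda>i. ennreal (enn2real (u i))) sums ennreal (enn2real (suminf u))"
    using assms by (simp add: summable_sums)
  then show ?thesis by (subst (asm) sums_ennreal) auto
qed

lemma integral_sum_measure:
  fixes f :: "'a \<Rightarrow> real"
  assumes sets: "\<And>i. sets (N i) = sets M" and f: "integrable (sum_measure M N) f"
  shows "(\<lambda>i. \<integral>x. f x \<partial>N i) sums (\<integral>x. f x \<partial>sum_measure M N)"
proof -
  have M: "f \<in> borel_measurable M"
    using borel_measurable_integrable[OF f] by (simp cong: measurable_cong_sets)
  then have N: "f \<in> borel_measurable (N i)" for i
    using sets by (simp cong: measurable_cong_sets)
  \<comment> \<open>\<open>ennreal\<close> clips negative values, so the choices \<open>f\<close>,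
    \<open>- f\<close> and \<open>\<bar>f\<bar>\<close> of \<open>g\<close> yield the positive part,
    the negative part and the absolute value.\<close>
  have fin: "(\<Sum>i. \<integral>\<^sup>+x. ennreal (g x) \<partial>N i) < \<infinity>" if "g \<in> borel_measurable M" "\<And>x. g x \<le> \<bar>f x\<bar>" for g
  proof -
    have "(\<integral>\<^sup>+x. ennreal (g x) \<partial>sum_measure M N) \<le> (\<integral>\<^sup>+x. ennreal (norm (f x)) \<partial>sum_measure M N)"
      using that by (intro nn_integral_mono) (auto intro!: ennreal_leI)
    also have "\<dots> < \<infinity>" using f by (simp add: integrable_iff_bounded)
    finally show ?thesis using that sets by (simp add: nn_integral_sum_measure)
  qed
  have int: "integrable (N i) f" for i
    using fin[of "\<lambda>x. \<bar>f x\<bar>"] M N ennreal_suminf_lessD[of "\<lambda>i. \<integral>\<^sup>+x. ennreal \<bar>f x\<bar> \<partial>N i" \<infinity> i]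
    by (simp add: integrable_iff_bounded)
  have "(\<lambda>i. enn2real (\<integral>\<^sup>+x. ennreal (g x) \<partial>N i)) sums enn2real (\<integral>\<^sup>+x. ennreal (g x) \<partial>sum_measure M N)"
    if "g \<in> borel_measurable M" "\<And>x. g x \<le> \<bar>f x\<bar>" for g
    using sums_enn2real[OF fin[OF that]] that sets by (simp add: nn_integral_sum_measure)
  from sums_diff[OF this[of f] this[of "\<lambda>x. - f x"]]
  show "(\<lambda>i. \<integral>x. f x \<partial>N i) sums (\<integral>x. f x \<partial>sum_measure M N)"
    using M f int by (simp add: real_lebesgue_integral_def)
qed

definition add_measure :: "'a measure \<Rightarrow> 'a measure \<Rightarrow> 'a measure" where
  "add_measure A B = measure_of (space A) (sets A) (\<lambda>E. emeasure A E + emeasure B E)"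

lemma
  shows space_add_measure[simp]: "space (add_measure A B) = space A"
    and sets_add_measure[simp, measurable_cong]: "sets (add_measure A B) = sets A"
  by (auto simp: add_measure_def)

lemma suminf_two_ennreal:
  "(\<Sum>i. if i = 0 then a else if i = 1 then b else 0) = a + (b :: ennreal)"
  by (subst suminf_finite[of "{0, 1::nat}"]) auto

text \<open>Padding with null measures lets the formulas for series of measures carry over to two
  summands.\<close>

lemma add_measure_eq_sum_measure:
  assumes "sets B = sets A"
  shows "add_measure A B = sum_measure A (\<lambda>i. if i = 0 then A else if i = 1 then B else null_measure A)"
  unfolding add_measure_def sum_measure_def
  by (rule measure_of_eq)
     (auto simp: sets.space_closed suminf_two_ennreal[symmetric] intro!: suminf_cong)

lemma emeasure_add_measure:
  assumes "sets B = sets A" "E \<in> sets A"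
  shows "emeasure (add_measure A B) E = emeasure A E + emeasure B E"
  using assms unfolding add_measure_eq_sum_measure[OF assms(1)]
  by (subst emeasure_sum_measure)
     (auto simp: suminf_two_ennreal[symmetric] intro!: suminf_cong)

lemma nn_integral_add_measure:
  assumes "sets B = sets A" "f \<in> borel_measurable A"
  shows "(\<integral>\<^sup>+x. f x \<partial>add_measure A B) = (\<integral>\<^sup>+x. f x \<partial>A) + (\<integral>\<^sup>+x. f x \<partial>B)"
  using assms unfolding add_measure_eq_sum_measure[OF assms(1)]
  by (subst nn_integral_sum_measure)
     (auto simp: suminf_two_ennreal[symmetric] intro!: suminf_cong)

lemma finite_add_measure:
  assumes "sets B = sets A" "finite_measure A" "finite_measure B"
  shows "finite_measure (add_measure A B)"
  using assms sets_eq_imp_space_eq[OF assms(1)]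
  by (intro finite_measureI)
     (auto simp: emeasure_add_measure finite_measure.emeasure_finite ennreal_add_eq_top)

lemma measure_add_measure:
  assumes "sets B = sets A" "finite_measure A" "finite_measure B" "E \<in> sets A"
  shows "measure (add_measure A B) E = measure A E + measure B E"
  using assms emeasure_add_measure[of B A E] finite_add_measure[of B A]
  by (simp add: finite_measure.emeasure_eq_measure flip: ennreal_plus)

lemma
  fixes f :: "'a \<Rightarrow> real"
  assumes "sets B = sets A" "integrable A f" "integrable B f"
  shows integrable_add_measure: "integrable (add_measure A B) f"
    and integral_add_measure:
      "(\<integral>x. f x \<partial>add_measure A B) = (\<integral>x. f x \<partial>A) + (\<integral>x. f x \<partial>B)"
proof -
  have f: "f \<in> borel_measurable A" using assms by auto
  show int: "integrable (add_measure A B) f"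
    using assms f by (auto simp: integrable_iff_bounded nn_integral_add_measure
        cong: measurable_cong_sets)
  have "(\<integral>\<^sup>+x. ennreal (f x) \<partial>A) < \<infinity>" "(\<integral>\<^sup>+x. ennreal (f x) \<partial>B) < \<infinity>"
    "(\<integral>\<^sup>+x. ennreal (- f x) \<partial>A) < \<infinity>" "(\<integral>\<^sup>+x. ennreal (- f x) \<partial>B) < \<infinity>"
    using assms by (auto simp: real_integrable_def less_top)
  then show "(\<integral>x. f x \<partial>add_measure A B) = (\<integral>x. f x \<partial>A) + (\<integral>x. f x \<partial>B)"
    using assms f int by (simp add: real_lebesgue_integral_def nn_integral_add_measure enn2real_plus)
qed

subsection \<open>Jordan decompositions\<close>

text \<open>Mutually singular measures are the Jordan parts of their difference: the supremum in
  \<open>pos_part\<close> is attained at \<open>A \<inter> Y\<close>, where \<open>b\<close>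
  vanishes and where all the mass of \<open>a\<close> in \<open>A\<close> lies.\<close>

lemma pos_part_eq_singular:
  assumes fin: "finite_measure a" "finite_measure b"
    and sets: "sets a = sets M" "sets b = sets M"
    and R: "\<And>E. E \<in> sets M \<Longrightarrow> R E = measure a E - measure b E"
    and Y: "Y \<in> sets M" "emeasure a (space M - Y) = 0" "emeasure b Y = 0"
  shows "pos_part M R = a"
proof -
  interpret a: finite_measure a by fact
  interpret b: finite_measure b by fact
  have sp: "space a = space M" using sets(1) by (rule sets_eq_imp_space_eq)
  have *: "(SUP B\<in>{B \<in> sets M. B \<subseteq> A}. ennreal (R B)) = emeasure a A" if A: "A \<in> sets M" for A
  proof (rule antisym)
    show "(SUP B\<in>{B \<in> sets M. B \<subseteq> A}. ennreal (R B)) \<le> emeasure a A"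
    proof (rule SUP_least, clarify)
      fix B assume "B \<in> sets M" "B \<subseteq> A"
      then have "ennreal (R B) \<le> emeasure a B"
        using R by (auto simp: a.emeasure_eq_measure intro!: ennreal_leI)
      also have "\<dots> \<le> emeasure a A"
        using \<open>B \<subseteq> A\<close> A sets by (intro emeasure_mono) auto
      finally show "ennreal (R B) \<le> emeasure a A" .
    qed
    have 1: "emeasure b (A \<inter> Y) = 0"
      using Y A sets emeasure_mono[of "A \<inter> Y" Y b] by auto
    have 2: "emeasure a (A - Y) = 0"
      using Y A sets sets.sets_into_space[OF A] emeasure_mono[of "A - Y" "space M - Y" a] by auto
    have "emeasure a A = emeasure a (A \<inter> Y) + emeasure a (A - Y)"
      using A Y sets by (subst plus_emeasure) (auto intro!: arg_cong[where f="emeasure a"])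
    also have "\<dots> = ennreal (R (A \<inter> Y))"
      using A Y 1 2 by (subst R) (auto simp: a.emeasure_eq_measure b.emeasure_eq_measure)
    finally show "emeasure a A \<le> (SUP B\<in>{B \<in> sets M. B \<subseteq> A}. ennreal (R B))"
      using A Y by (auto intro!: SUP_upper2[of "A \<inter> Y"])
  qed
  have "pos_part M R = measure_of (space M) (sets M) (emeasure a)"
    unfolding pos_part_def by (rule measure_of_eq) (simp_all add: sets.space_closed * sets.sigma_sets_eq)
  also have "\<dots> = a"
    using sets sp measure_of_of_measure[of a] by simp
  finally show ?thesis .
qed

lemma neg_part_eq_singular:
  assumes fin: "finite_measure a" "finite_measure b"
    and sets: "sets a = sets M" "sets b = sets M"
    and R: "\<And>E. E \<in> sets M \<Longrightarrow> R E = measure a E - measure b E"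
    and Y: "Y \<in> sets M" "emeasure a (space M - Y) = 0" "emeasure b Y = 0"
  shows "neg_part M R = b"
  unfolding neg_part_def
proof (rule pos_part_eq_singular[OF fin(2,1) sets(2,1)])
  show "space M - Y \<in> sets M" "emeasure b (space M - (space M - Y)) = 0"
    "emeasure a (space M - Y) = 0"
    using Y sets.sets_into_space[OF Y(1)] by (auto simp: Diff_Diff_Int Int_absorb1)
qed (simp add: R)

text \<open>Subtraction of extended nonnegative reals is truncated; this is the exit from the
  additive form to real differences.\<close>

lemma measure_diff_eqI_emeasure:
  assumes "finite_measure p" "finite_measure n" "finite_measure a" "finite_measure b"
    and "emeasure p E + emeasure b E = emeasure n E + emeasure a E"
  shows "measure p E - measure n E = measure a E - measure b E"
proof -
  have "measure p E + measure b E = measure n E + measure a E"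
    using assms by (simp add: finite_measure.emeasure_eq_measure flip: ennreal_plus)
  then show ?thesis by simp
qed

text \<open>The Jordan parts \<open>p\<close>, \<open>n\<close> of \<open>a - b\<close>, with Hahn
  set \<open>Y\<close>. The additive form of \<open>eq\<close> can be integrated even when some
  integrals are infinite, which is what the finiteness arguments for \<open>V\<close> rely on;
  \<open>le\<close> is the minimality of the Jordan parts.\<close>

locale jordan_pair =
  fixes M :: "'a measure" and a b p n :: "'a measure" and Y :: "'a set"
  assumes sets: "sets a = sets M" "sets b = sets M" "sets p = sets M" "sets n = sets M"
    and fin: "finite_measure a" "finite_measure b" "finite_measure p" "finite_measure n"
    and Y: "Y \<in> sets M" "emeasure p (space M - Y) = 0" "emeasure n Y = 0"
    and eq: "add_measure p b = add_measure n a"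
    and le: "\<And>E. E \<in> sets M \<Longrightarrow> emeasure p E \<le> emeasure a E"
      "\<And>E. E \<in> sets M \<Longrightarrow> emeasure n E \<le> emeasure b E"
begin

lemma measure_eq:
  assumes "E \<in> sets M"
  shows "measure p E - measure n E = measure a E - measure b E"
proof -
  have "emeasure p E + emeasure b E = emeasure n E + emeasure a E"
    using arg_cong[OF eq, of "\<lambda>m. emeasure m E"] sets assms by (simp add: emeasure_add_measure)
  then show ?thesis by (intro measure_diff_eqI_emeasure fin)
qed

lemma nn_integral_eq:
  assumes "f \<in> borel_measurable M"
  shows "(\<integral>\<^sup>+x. f x \<partial>p) + (\<integral>\<^sup>+x. f x \<partial>b) = (\<integral>\<^sup>+x. f x \<partial>n) + (\<integral>\<^sup>+x. f x \<partial>a)"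
proof -
  have "f \<in> borel_measurable p" "f \<in> borel_measurable n"
    using assms sets by (simp_all cong: measurable_cong_sets)
  then show ?thesis
    using arg_cong[OF eq, of "\<lambda>m. \<integral>\<^sup>+x. f x \<partial>m"] sets by (simp add: nn_integral_add_measure)
qed

lemma nn_integral_le:
  "(\<integral>\<^sup>+x. f x \<partial>p) \<le> (\<integral>\<^sup>+x. f x \<partial>a)" "(\<integral>\<^sup>+x. f x \<partial>n) \<le> (\<integral>\<^sup>+x. f x \<partial>b)"
proof -
  have "p \<le> a" "n \<le> b" by (simp_all add: le_measure sets le)
  then show "(\<integral>\<^sup>+x. f x \<partial>p) \<le> (\<integral>\<^sup>+x. f x \<partial>a)" "(\<integral>\<^sup>+x. f x \<partial>n) \<le> (\<integral>\<^sup>+x. f x \<partial>b)"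
    by (simp_all add: nn_integral_mono_measure sets)
qed

lemma pos_part_eq:
  assumes "\<And>E. E \<in> sets M \<Longrightarrow> R E = measure a E - measure b E"
  shows "pos_part M R = p"
  by (rule pos_part_eq_singular[OF fin(3,4) sets(3,4) _ Y]) (simp add: assms measure_eq)

lemma neg_part_eq:
  assumes "\<And>E. E \<in> sets M \<Longrightarrow> R E = measure a E - measure b E"
  shows "neg_part M R = n"
  by (rule neg_part_eq_singular[OF fin(3,4) sets(3,4) _ Y]) (simp add: assms measure_eq)

end

text \<open>On a Hahn set \<open>Y\<close> the measure \<open>a\<close> dominates \<open>b\<close>,
  and off \<open>Y\<close> it is the other way round; \<open>p\<close> and \<open>n\<close> are the
  two differences on these halves.\<close>

lemma jordan_pair_exists:
  assumes fin: "finite_measure a" "finite_measure b" and sets: "sets a = sets M" "sets b = sets M"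
  obtains p n Y where "jordan_pair M a b p n Y"
proof -
  interpret a: finite_measure a by fact
  interpret b: finite_measure b by fact
  obtain Y where Y: "Y \<in> sets M"
    and ba: "\<And>X. X \<in> sets M \<Longrightarrow> X \<subseteq> Y \<Longrightarrow> emeasure b X \<le> emeasure a X"
    and ab: "\<And>X. X \<in> sets M \<Longrightarrow> X \<inter> Y = {} \<Longrightarrow> emeasure a X \<le> emeasure b X"
    using finite_unsigned_Hahn_decomposition[OF fin] sets by auto
  \<comment> \<open>Restriction by a density keeps the underlying space \<open>M\<close>, so the
    halves can be compared with \<open>a\<close> and \<open>b\<close>.\<close>
  define res where "res m Z = density m (indicator Z)" for m :: "'a measure" and Z
  have res_sets[simp]: "sets (res m Z) = sets m" "space (res m Z) = space m" for m Z
    by (simp_all add: res_def)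
  have res: "emeasure (res m Z) X = emeasure m (X \<inter> Z)"
    if "sets m = sets M" "Z \<in> sets M" "X \<in> sets M" for m Z X
    using that unfolding res_def by (subst emeasure_density) (auto simp: Int_commute
        simp flip: indicator_inter_arith)
  have Yc: "space M - Y \<in> sets M" using Y by auto
  have res_fin: "finite_measure (res m Z)" if "sets m = sets M" "Z \<in> sets M" "finite_measure m" for m Z
    using that sets_eq_imp_space_eq[OF that(1)]
    by (intro finite_measureI) (auto simp: res finite_measure.emeasure_finite)
  define p where "p = diff_measure (res a Y) (res b Y)"
  define n where "n = diff_measure (res b (space M - Y)) (res a (space M - Y))"
  have p: "emeasure p X = emeasure a (X \<inter> Y) - emeasure b (X \<inter> Y)" if "X \<in> sets M" for X
    using that Y sets fin ba unfolding p_def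
    by (subst emeasure_diff_measure) (auto intro!: res_fin simp: res)
  have n: "emeasure n X = emeasure b (X \<inter> (space M - Y)) - emeasure a (X \<inter> (space M - Y))"
    if "X \<in> sets M" for X
    using that Yc sets fin ab unfolding n_def
    by (subst emeasure_diff_measure) (auto intro!: res_fin ab simp: res simp del: sets.Diff)
  have sets': "sets p = sets M" "sets n = sets M" using sets by (simp_all add: p_def n_def)
  have ple: "emeasure p E \<le> emeasure a E" if "E \<in> sets M" for E
  proof -
    have "emeasure p E \<le> emeasure a (E \<inter> Y)" using that by (simp add: p diff_le_self_ennreal)
    also have "\<dots> \<le> emeasure a E" using that sets by (intro emeasure_mono) auto
    finally show ?thesis .
  qed
  have nle: "emeasure n E \<le> emeasure b E" if "E \<in> sets M" for E
  proof -
    have "emeasure n E \<le> emeasure b (E \<inter> (space M - Y))" using that by (simp add: n diff_le_self_ennreal)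
    also have "\<dots> \<le> emeasure b E" using that sets by (intro emeasure_mono) auto
    finally show ?thesis .
  qed
  have spp: "space p = space M" "space n = space M" using sets' by (auto dest: sets_eq_imp_space_eq)
  have sp: "space a = space M" "space b = space M" using sets by (auto dest: sets_eq_imp_space_eq)
  have finp: "finite_measure p" "finite_measure n"
    using ple[of "space M"] nle[of "space M"] a.emeasure_finite b.emeasure_finite
    by (auto intro!: finite_measureI simp: spp top_unique)
  have eq: "emeasure p E + emeasure b E = emeasure n E + emeasure a E" if E: "E \<in> sets M" for E
  proof -
    let ?Z = "space M - Y"
    have split: "emeasure m E = emeasure m (E \<inter> Y) + emeasure m (E \<inter> ?Z)" if "sets m = sets M" for m
      using E Y that sets.sets_into_space[OF E]
      by (subst plus_emeasure) (auto intro!: arg_cong[where f="emeasure m"])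
    \<comment> \<open>The comparisons from Hahn's theorem make the truncated differences exact, so
      the subtracted mass can be added back on each half.\<close>
    have 1: "emeasure p E + emeasure b (E \<inter> Y) = emeasure a (E \<inter> Y)"
      using E Y ba[of "E \<inter> Y"] by (simp add: p diff_add_cancel_ennreal)
    have 2: "emeasure n E + emeasure a (E \<inter> ?Z) = emeasure b (E \<inter> ?Z)"
    proof -
      have "E \<inter> ?Z \<in> sets M" using E Yc by (rule sets.Int)
      then have "emeasure a (E \<inter> ?Z) \<le> emeasure b (E \<inter> ?Z)" by (rule ab) auto
      then show ?thesis unfolding n[OF E] by (rule diff_add_cancel_ennreal)
    qed
    show ?thesis
      using sets by (simp add: split[of a] split[of b] 1[symmetric] 2[symmetric] ac_simps)
  qed
  show thesis
  proof (rule that[of p n Y], rule jordan_pair.intro)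
    show "add_measure p b = add_measure n a"
      using sets sets' eq by (intro measure_eqI) (auto simp: emeasure_add_measure)
    show "emeasure p (space M - Y) = 0" using Y by (simp add: p Int_commute[of _ Y])
    show "emeasure n Y = 0" using Y by (simp add: n Int_commute[of _ Y])
  qed (simp_all add: sets sets' fin finp Y ple nle)
qed

lemma
  shows sets_pos_part[simp, measurable_cong]: "sets (pos_part M R) = sets M"
    and sets_neg_part[simp, measurable_cong]: "sets (neg_part M R) = sets M"
    and space_pos_part[simp]: "space (pos_part M R) = space M"
    and space_neg_part[simp]: "space (neg_part M R) = space M"
    and space_total_variation[simp]: "space (total_variation M R) = space M"
  by (auto simp: pos_part_def neg_part_def total_variation_def)

lemma nn_integral_total_variation:
  assumes "f \<in> borel_measurable M"
  shows "(\<integral>\<^sup>+x. f x \<partial>total_variation M R) = (\<integral>\<^sup>+x. f x \<partial>pos_part M R) + (\<integral>\<^sup>+x. f x \<partial>neg_part M R)"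
proof -
  have "total_variation M R = add_measure (pos_part M R) (neg_part M R)"
    by (simp add: total_variation_def add_measure_def pos_part_def)
  moreover have "sets (neg_part M R) = sets (pos_part M R)"
    by (simp add: neg_part_def pos_part_def)
  moreover have "f \<in> borel_measurable (pos_part M R)"
    using assms by (simp add: pos_part_def cong: measurable_cong_sets)
  ultimately show ?thesis by (simp add: nn_integral_add_measure)
qed

text \<open>The decomposition of \<open>R\<close> into \<open>a - b\<close> need not be the Jordan decomposition.\<close>

lemma
  fixes f :: "'a \<Rightarrow> real"
  assumes fin: "finite_measure a" "finite_measure b" and sets: "sets a = sets M" "sets b = sets M"
    and R: "\<And>E. E \<in> sets M \<Longrightarrow> R E = measure a E - measure b E"
    and f: "integrable a f" "integrable b f"
  shows signed_integral_eq_diff: "signed_integral M R f = (\<integral>x. f x \<partial>a) - (\<integral>x. f x \<partial>b)"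
    and signed_integrable_diff: "signed_integrable M R f"
    and integrable_pos_part: "integrable (pos_part M R) f"
    and integrable_neg_part: "integrable (neg_part M R) f"
proof -
  obtain p n Y where "jordan_pair M a b p n Y"
    using jordan_pair_exists[OF fin sets] .
  then interpret jordan_pair M a b p n Y .
  have M: "f \<in> borel_measurable M"
    using f(1) sets(1) by (auto dest!: borel_measurable_integrable cong: measurable_cong_sets)
  then have "f \<in> borel_measurable p" "f \<in> borel_measurable n"
    using sets by (simp_all cong: measurable_cong_sets)
  then have int: "integrable p f" "integrable n f"
    using f nn_integral_le[of "\<lambda>x. ennreal (norm (f x))"]
    by (auto simp: integrable_iff_bounded intro: le_less_trans)
  \<comment> \<open>The identity \<open>p + b = n + a\<close> integrated; all four integrals are
    finite by now, so terms may change sides.\<close>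
  have "(\<integral>x. f x \<partial>p) + (\<integral>x. f x \<partial>b) = (\<integral>x. f x \<partial>n) + (\<integral>x. f x \<partial>a)"
    using arg_cong[OF eq, of "\<lambda>m. \<integral>x. f x \<partial>m"] sets int f by (simp add: integral_add_measure)
  then show "signed_integral M R f = (\<integral>x. f x \<partial>a) - (\<integral>x. f x \<partial>b)"
    using R by (simp add: signed_integral_def pos_part_eq neg_part_eq)
  show "integrable (pos_part M R) f" "integrable (neg_part M R) f"
    using int R by (simp_all add: pos_part_eq neg_part_eq)
  have "(\<integral>\<^sup>+x. ennreal (norm (f x)) \<partial>total_variation M R) < \<infinity>"
    using M int R by (subst nn_integral_total_variation)
      (auto simp: pos_part_eq neg_part_eq integrable_iff_bounded)
  then show "signed_integrable M R f"
    unfolding signed_integrable_def using M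
    by (auto simp: integrable_iff_bounded total_variation_def cong: measurable_cong_sets)
qed

lemma finite_signed_measure_diff:
  assumes fin: "finite_measure a" "finite_measure b" and sets: "sets a = sets M" "sets b = sets M"
    and R: "\<And>E. E \<in> sets M \<Longrightarrow> R E = measure a E - measure b E"
  shows "finite_signed_measure M R"
  unfolding finite_signed_measure_def
proof (intro allI impI)
  fix A :: "nat \<Rightarrow> 'a set" assume A: "range A \<subseteq> sets M" "disjoint_family A"
  then have "(\<lambda>i. measure a (A i) - measure b (A i)) sums (measure a (\<Union>i. A i) - measure b (\<Union>i. A i))"
    using fin sets by (intro sums_diff finite_measure.finite_measure_UNION) auto
  moreover have "R (A i) = measure a (A i) - measure b (A i)" for i
    using A by (intro R) auto
  ultimately show "(\<lambda>i. R (A i)) sums R (\<Union>i. A i)"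
    using A R[of "\<Union>i. A i"] by auto
qed

subsection \<open>Products of signed measures\<close>

lemma pair_sigma_finiteI:
  "finite_measure A \<Longrightarrow> finite_measure B \<Longrightarrow> pair_sigma_finite A B"
  by (simp add: pair_sigma_finite_def finite_measure_def)

context jordan_pair
begin

text \<open>The mass under \<open>l\<close> of the sections of \<open>E\<close> is a nonnegative
  function of the first coordinate, and integrating it against \<open>p + b = n + a\<close>
  transports that identity to the products.\<close>

lemma measure_pair_left:
  assumes l: "finite_measure l" "sets l = sets N" and E: "E \<in> sets (M \<Otimes>\<^sub>M N)"
  shows "measure (p \<Otimes>\<^sub>M l) E - measure (n \<Otimes>\<^sub>M l) E = measure (a \<Otimes>\<^sub>M l) E - measure (b \<Otimes>\<^sub>M l) E"
proof -
  interpret l: finite_measure l by fact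
  have E': "E \<in> sets (k \<Otimes>\<^sub>M l)" if "sets k = sets M" for k
    using E that l by (simp cong: sets_pair_measure_cong)
  have "emeasure (p \<Otimes>\<^sub>M l) E + emeasure (b \<Otimes>\<^sub>M l) E = emeasure (n \<Otimes>\<^sub>M l) E + emeasure (a \<Otimes>\<^sub>M l) E"
    using sets by (simp add: l.emeasure_pair_measure_alt E' nn_integral_eq l.measurable_emeasure_Pair)
  then show ?thesis
    by (intro measure_diff_eqI_emeasure finite_measure_pair_measure fin l)
qed

text \<open>As on the left, but with sections in the other coordinate, so the product measure is
  expanded in the reverse order.\<close>

lemma measure_pair_right:
  assumes l: "finite_measure l" "sets l = sets N" and E: "E \<in> sets (N \<Otimes>\<^sub>M M)"
  shows "measure (l \<Otimes>\<^sub>M p) E - measure (l \<Otimes>\<^sub>M n) E = measure (l \<Otimes>\<^sub>M a) E - measure (l \<Otimes>\<^sub>M b) E"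
proof -
  have E': "E \<in> sets (l \<Otimes>\<^sub>M k)" if "sets k = sets M" for k
    using E that l by (simp cong: sets_pair_measure_cong)
  have alt: "emeasure (l \<Otimes>\<^sub>M k) E = (\<integral>\<^sup>+y. emeasure l ((\<lambda>x. (x, y)) -` E) \<partial>k)"
    if "finite_measure k" "sets k = sets M" for k
    using that l by (intro pair_sigma_finite.emeasure_pair_measure_alt2 pair_sigma_finiteI E')
  have [measurable]: "(\<lambda>y. emeasure l ((\<lambda>x. (x, y)) -` E)) \<in> borel_measurable M"
    using pair_sigma_finite.measurable_emeasure_Pair2[OF pair_sigma_finiteI[OF l(1) fin(1)] E'[OF sets(1)]] sets
    by (simp cong: measurable_cong_sets)
  have "emeasure (l \<Otimes>\<^sub>M p) E + emeasure (l \<Otimes>\<^sub>M b) E = emeasure (l \<Otimes>\<^sub>M n) E + emeasure (l \<Otimes>\<^sub>M a) E"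
    by (simp add: alt fin sets nn_integral_eq)
  then show ?thesis
    by (intro measure_diff_eqI_emeasure finite_measure_pair_measure fin l)
qed

end

locale jordan_pair_prod =
  J1: jordan_pair M1 a1 b1 p1 n1 Y1 + J2: jordan_pair M2 a2 b2 p2 n2 Y2
  for M1 :: "'a measure" and a1 b1 p1 n1 Y1
    and M2 :: "'b measure" and a2 b2 p2 n2 Y2
begin

abbreviation "R \<equiv> signed_pair M1 (measure_diff a1 b1) M2 (measure_diff a2 b2)"

lemma signed_pair_jordan:
  "R E = measure (p1 \<Otimes>\<^sub>M p2) E - measure (p1 \<Otimes>\<^sub>M n2) E - measure (n1 \<Otimes>\<^sub>M p2) E + measure (n1 \<Otimes>\<^sub>M n2) E"
  by (simp add: signed_pair_def measure_diff_def
      J1.pos_part_eq[of "measure_diff a1 b1"] J1.neg_part_eq[of "measure_diff a1 b1"]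
      J2.pos_part_eq[of "measure_diff a2 b2"] J2.neg_part_eq[of "measure_diff a2 b2"])

text \<open>The product of signed measures does not depend on how its factors are decomposed: the
  second factor is exchanged against \<open>p1\<close> and \<open>n1\<close>, then the first against
  \<open>a2\<close> and \<open>b2\<close>. This brings the kernels and \<mu> themselves into
  play.\<close>

lemma signed_pair_eq:
  assumes E: "E \<in> sets (M1 \<Otimes>\<^sub>M M2)"
  shows "R E = measure (a1 \<Otimes>\<^sub>M a2) E - measure (a1 \<Otimes>\<^sub>M b2) E - measure (b1 \<Otimes>\<^sub>M a2) E + measure (b1 \<Otimes>\<^sub>M b2) E"
  using J2.measure_pair_right[OF J1.fin(3) J1.sets(3) E] J2.measure_pair_right[OF J1.fin(4) J1.sets(4) E]
    J1.measure_pair_left[OF J2.fin(1) J2.sets(1) E] J1.measure_pair_left[OF J2.fin(2) J2.sets(2) E]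
  unfolding signed_pair_jordan by linarith

lemma sets_prod:
  "k \<in> {a1, b1, p1, n1} \<Longrightarrow> l \<in> {a2, b2, p2, n2} \<Longrightarrow> sets (k \<Otimes>\<^sub>M l) = sets (M1 \<Otimes>\<^sub>M M2)"
  using J1.sets J2.sets by (intro sets_pair_measure_cong) auto

lemma finite_prod:
  "k \<in> {a1, b1, p1, n1} \<Longrightarrow> l \<in> {a2, b2, p2, n2} \<Longrightarrow> finite_measure (k \<Otimes>\<^sub>M l)"
  using J1.fin J2.fin by (intro finite_measure_pair_measure) auto

text \<open>Equal signs of the factors give the positive part and opposite signs the negative one.
  Accordingly the Hahn set \<open>?Y\<close> consists of the two rectangles on which the signs
  agree.\<close>

lemma signed_pair_parts:
  shows "pos_part (M1 \<Otimes>\<^sub>M M2) R = add_measure (p1 \<Otimes>\<^sub>M p2) (n1 \<Otimes>\<^sub>M n2)"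
    and "neg_part (M1 \<Otimes>\<^sub>M M2) R = add_measure (p1 \<Otimes>\<^sub>M n2) (n1 \<Otimes>\<^sub>M p2)"
proof -
  let ?a = "add_measure (p1 \<Otimes>\<^sub>M p2) (n1 \<Otimes>\<^sub>M n2)" and ?b = "add_measure (p1 \<Otimes>\<^sub>M n2) (n1 \<Otimes>\<^sub>M p2)"
  let ?Z1 = "space M1 - Y1" and ?Z2 = "space M2 - Y2"
  let ?Y = "Y1 \<times> Y2 \<union> ?Z1 \<times> ?Z2" and ?M = "M1 \<Otimes>\<^sub>M M2"
  have fin: "finite_measure ?a" "finite_measure ?b"
    by (auto intro!: finite_add_measure finite_prod simp: sets_prod)
  have sets: "sets ?a = sets ?M" "sets ?b = sets ?M"
    by (simp_all add: sets_prod)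
  have R: "R E = measure ?a E - measure ?b E" if "E \<in> sets ?M" for E
    using that by (simp add: measure_add_measure finite_prod sets_prod signed_pair_jordan)
  have Yin: "?Y \<in> sets ?M" using J1.Y J2.Y by auto
  have Ysub: "Y1 \<subseteq> space M1" "Y2 \<subseteq> space M2"
    using J1.Y J2.Y by (auto dest: sets.sets_into_space)
  \<comment> \<open>A set covered by two rectangles, each with a null side, is null. This serves
    both \<open>?a\<close> off \<open>?Y\<close> and \<open>?b\<close> on \<open>?Y\<close>.\<close>
  have null: "emeasure (k \<Otimes>\<^sub>M l) E = 0"
    if "k \<in> {p1, n1}" "l \<in> {p2, n2}" "E \<in> sets ?M" "E \<subseteq> A \<times> B \<union> C \<times> D"
      "A \<in> sets M1" "B \<in> sets M2" "C \<in> sets M1" "D \<in> sets M2"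
      "emeasure k A = 0 \<or> emeasure l B = 0" "emeasure k C = 0 \<or> emeasure l D = 0"
    for k l A B C D E
  proof -
    have s: "sets k = sets M1" "sets l = sets M2" and f: "finite_measure l"
      using that(1,2) J1.sets J2.sets J2.fin by auto
    interpret l: finite_measure l by fact
    have "emeasure (k \<Otimes>\<^sub>M l) E \<le> emeasure (k \<Otimes>\<^sub>M l) (A \<times> B \<union> C \<times> D)"
      using that s by (intro emeasure_mono) auto
    also have "\<dots> \<le> emeasure (k \<Otimes>\<^sub>M l) (A \<times> B) + emeasure (k \<Otimes>\<^sub>M l) (C \<times> D)"
      using that s by (intro emeasure_subadditive) auto
    also have "\<dots> = 0"
      using that s by (auto simp: l.emeasure_pair_measure_Times)
    finally show ?thesis by simp
  qed
  have c: "space ?M - ?Y \<in> sets ?M" "space ?M - ?Y \<subseteq> Y1 \<times> ?Z2 \<union> ?Z1 \<times> Y2"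
    using Yin by (auto simp: space_pair_measure)
  have 1: "emeasure ?a (space ?M - ?Y) = 0"
    using c J1.Y J2.Y
    by (subst emeasure_add_measure)
       (auto simp: sets_prod intro!: null[where A = Y1 and B = ?Z2 and C = ?Z1 and D = Y2])
  have 2: "emeasure ?b ?Y = 0"
    using Yin J1.Y J2.Y
    by (subst emeasure_add_measure)
       (auto simp: sets_prod intro!: null[where A = Y1 and B = Y2 and C = ?Z1 and D = ?Z2])
  show "pos_part ?M R = ?a"
    by (rule pos_part_eq_singular[OF fin sets R Yin 1 2])
  show "neg_part ?M R = ?b"
    by (rule neg_part_eq_singular[OF fin sets R Yin 1 2])
qed

lemma signed_pair_eq_parts:
  assumes "E \<in> sets (M1 \<Otimes>\<^sub>M M2)"
  shows "R E = measure (pos_part (M1 \<Otimes>\<^sub>M M2) R) E - measure (neg_part (M1 \<Otimes>\<^sub>M M2) R) E"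
  using assms unfolding signed_pair_parts
  by (simp add: measure_add_measure finite_prod sets_prod signed_pair_jordan)

lemma finite_signed_pair_parts:
  "finite_measure (pos_part (M1 \<Otimes>\<^sub>M M2) R)" "finite_measure (neg_part (M1 \<Otimes>\<^sub>M M2) R)"
  unfolding signed_pair_parts by (auto intro!: finite_add_measure finite_prod simp: sets_prod)

text \<open>With the four products displayed as nonnegative summands, finiteness of the norm passes
  to each of them.\<close>

lemma nn_integral_total_variation_signed_pair:
  assumes f: "f \<in> borel_measurable (M1 \<Otimes>\<^sub>M M2)"
  shows "(\<integral>\<^sup>+z. f z \<partial>total_variation (M1 \<Otimes>\<^sub>M M2) R) =
    (\<integral>\<^sup>+z. f z \<partial>(p1 \<Otimes>\<^sub>M p2)) + (\<integral>\<^sup>+z. f z \<partial>(n1 \<Otimes>\<^sub>M n2)) +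
    ((\<integral>\<^sup>+z. f z \<partial>(p1 \<Otimes>\<^sub>M n2)) + (\<integral>\<^sup>+z. f z \<partial>(n1 \<Otimes>\<^sub>M p2)))"
proof -
  have "f \<in> borel_measurable (p1 \<Otimes>\<^sub>M p2)" "f \<in> borel_measurable (p1 \<Otimes>\<^sub>M n2)"
    using f sets_prod by (simp_all cong: measurable_cong_sets)
  then show ?thesis
    using f by (simp add: nn_integral_total_variation signed_pair_parts nn_integral_add_measure sets_prod)
qed

text \<open>The two halves of the bilinear expansion need not be mutually singular, so the integral
  is evaluated through an arbitrary decomposition and not through the Jordan parts.\<close>

lemma signed_integral_signed_pair:
  fixes f :: "'a \<times> 'b \<Rightarrow> real"
  assumes "integrable (a1 \<Otimes>\<^sub>M a2) f" "integrable (a1 \<Otimes>\<^sub>M b2) f"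
    "integrable (b1 \<Otimes>\<^sub>M a2) f" "integrable (b1 \<Otimes>\<^sub>M b2) f"
  shows "signed_integral (M1 \<Otimes>\<^sub>M M2) R f =
      (\<integral>z. f z \<partial>(a1 \<Otimes>\<^sub>M a2)) - (\<integral>z. f z \<partial>(a1 \<Otimes>\<^sub>M b2)) - (\<integral>z. f z \<partial>(b1 \<Otimes>\<^sub>M a2)) + (\<integral>z. f z \<partial>(b1 \<Otimes>\<^sub>M b2))"
    and "integrable (pos_part (M1 \<Otimes>\<^sub>M M2) R) f" "integrable (neg_part (M1 \<Otimes>\<^sub>M M2) R) f"
proof -
  let ?a = "add_measure (a1 \<Otimes>\<^sub>M a2) (b1 \<Otimes>\<^sub>M b2)" and ?b = "add_measure (a1 \<Otimes>\<^sub>M b2) (b1 \<Otimes>\<^sub>M a2)"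
  let ?M = "M1 \<Otimes>\<^sub>M M2"
  have R: "R E = measure ?a E - measure ?b E" if "E \<in> sets ?M" for E
    using that by (simp add: measure_add_measure finite_prod sets_prod signed_pair_eq)
  have fin: "finite_measure ?a" "finite_measure ?b"
    by (auto intro!: finite_add_measure finite_prod simp: sets_prod)
  have sets: "sets ?a = sets ?M" "sets ?b = sets ?M"
    by (simp_all add: sets_prod)
  have int: "integrable ?a f" "integrable ?b f"
    using assms by (auto intro!: integrable_add_measure simp: sets_prod)
  show "signed_integral ?M R f =
      (\<integral>z. f z \<partial>(a1 \<Otimes>\<^sub>M a2)) - (\<integral>z. f z \<partial>(a1 \<Otimes>\<^sub>M b2)) - (\<integral>z. f z \<partial>(b1 \<Otimes>\<^sub>M a2)) + (\<integral>z. f z \<partial>(b1 \<Otimes>\<^sub>M b2))"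
    using assms signed_integral_eq_diff[of ?a ?b ?M R f, OF fin sets R int]
    by (simp add: integral_add_measure sets_prod)
  show "integrable (pos_part ?M R) f"
    by (rule integrable_pos_part[of ?a ?b ?M R f, OF fin sets R int])
  show "integrable (neg_part ?M R) f"
    by (rule integrable_neg_part[of ?a ?b ?M R f, OF fin sets R int])
qed

end

text \<open>Integrating \<open>p + b = n + a\<close> bounds the integral under \<open>b\<close> by
  the integral under \<open>n\<close> plus \<open>f x\<close>, so all that matters is that
  \<open>f x\<close> is finite. Otherwise \<open>p\<close> would charge a set on which
  \<open>f\<close> is infinite.\<close>

lemma (in jordan_pair) nn_integral_b_finite:
  assumes a: "a = return M x" "x \<in> space M" "a \<noteq> b"
    and b: "prob_space b"
    and f: "f \<in> borel_measurable M" "(\<integral>\<^sup>+x. f x \<partial>p) < \<infinity>" "(\<integral>\<^sup>+x. f x \<partial>n) < \<infinity>"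
  shows "(\<integral>\<^sup>+x. f x \<partial>b) < \<infinity>"
proof -
  interpret b: prob_space b by fact
  have "f x < \<infinity>"
  proof (rule ccontr)
    assume "\<not> f x < \<infinity>"
    then have fx: "f x = \<infinity>" by (metis infinity_ennreal_def top.not_eq_extremum)
    obtain E where E: "E \<in> sets M" "emeasure a E \<noteq> emeasure b E"
      using a(3) measure_eqI[of a b] sets by auto
    \<comment> \<open>A set that separates the Dirac measure from \<open>b\<close>, or else its
      complement, contains \<open>x\<close> without having full measure under
      \<open>b\<close>.\<close>
    have "\<exists>E\<in>sets M. x \<in> E \<and> emeasure b E < 1"
    proof (cases "x \<in> E")
      case True
      then have "emeasure b E \<noteq> 1" using E a by auto
      then show ?thesis using True E b.emeasure_le_1[of E] by (auto simp: less_le)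
    next
      case False
      have sp: "space b = space M" using sets by (auto dest: sets_eq_imp_space_eq)
      have "emeasure b E > 0" using False E a by (auto simp: zero_less_iff_neq_zero)
      then have "b.prob E > 0" using b.emeasure_eq_measure by simp
      then have "b.prob (space b - E) < 1"
        using E sets by (subst b.prob_compl) auto
      then show ?thesis
        using False E a by (intro bexI[of _ "space M - E"]) (auto simp: b.emeasure_eq_measure sp)
    qed
    then obtain E where E: "E \<in> sets M" "x \<in> E" "emeasure b E < 1" by auto
    define B where "B = {z \<in> space M. f z = \<infinity>} \<inter> E"
    have B: "B \<in> sets M" using f E unfolding B_def by measurable
    have xB: "x \<in> B" using a fx E by (auto simp: B_def)
    have bB: "emeasure b B < 1"
      using E sets by (auto simp: B_def intro!: le_less_trans[OF emeasure_mono E(3)])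
    \<comment> \<open>The unit mass of \<open>a\<close> at \<open>x\<close> is too large to be
      absorbed by \<open>b\<close> on \<open>B\<close>, so \<open>p\<close> charges
      \<open>B\<close>, where \<open>f\<close> is infinite.\<close>
    have "1 \<le> emeasure p B + emeasure b B"
      using nn_integral_eq[of "indicator B"] B sets a xB by simp
    then have "emeasure p B \<noteq> 0" using bB by auto
    then have "\<infinity> = (\<integral>\<^sup>+z. \<infinity> * indicator B z \<partial>p)"
      using B sets by (subst nn_integral_cmult_indicator) (auto simp: ennreal_top_mult)
    also have "\<dots> \<le> (\<integral>\<^sup>+z. f z \<partial>p)"
      by (intro nn_integral_mono) (auto simp: B_def indicator_def)
    finally show False using f by auto
  qed
  have "(\<integral>\<^sup>+x. f x \<partial>b) \<le> (\<integral>\<^sup>+x. f x \<partial>p) + (\<integral>\<^sup>+x. f x \<partial>b)" by simp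
  also have "\<dots> = (\<integral>\<^sup>+x. f x \<partial>n) + f x"
    using nn_integral_eq[OF f(1)] a f(1) by (simp add: nn_integral_return)
  also have "\<dots> < \<infinity>" using \<open>f x < \<infinity>\<close> f by (simp add: ennreal_add_eq_top less_top)
  finally show ?thesis .
qed

text \<open>The second half of the passage from parts to measures: once \<open>b\<close> integrates
  \<open>f\<close>, so does \<open>p + b\<close>, which dominates \<open>a\<close>.\<close>

lemma (in jordan_pair) nn_integral_a_finite:
  assumes f: "f \<in> borel_measurable M" "(\<integral>\<^sup>+x. f x \<partial>p) < \<infinity>" "(\<integral>\<^sup>+x. f x \<partial>b) < \<infinity>"
  shows "(\<integral>\<^sup>+x. f x \<partial>a) < \<infinity>"
proof -
  have "(\<integral>\<^sup>+x. f x \<partial>a) \<le> (\<integral>\<^sup>+x. f x \<partial>n) + (\<integral>\<^sup>+x. f x \<partial>a)" by simp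
  also have "\<dots> = (\<integral>\<^sup>+x. f x \<partial>p) + (\<integral>\<^sup>+x. f x \<partial>b)"
    using nn_integral_eq[OF f(1)] by simp
  also have "\<dots> < \<infinity>" using f by (simp add: ennreal_add_eq_top less_top)
  finally show ?thesis .
qed

subsection \<open>Kernels and their products\<close>

text \<open>Fubini for a composed kernel and an unbounded integrand, reduced to the nonnegative case
  by splitting into positive and negative parts.\<close>

lemma
  fixes f :: "'b \<Rightarrow> real"
  assumes f: "f \<in> borel_measurable K" and N: "N \<in> M \<rightarrow>\<^sub>M subprob_algebra K"
    and int: "integrable (M \<bind> N) f"
  shows integrable_integral_kernel: "integrable M (\<lambda>x. \<integral>y. f y \<partial>N x)"
    and integral_bind_integrable: "(\<integral>y. f y \<partial>(M \<bind> N)) = (\<integral>x. \<integral>y. f y \<partial>N x \<partial>M)"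
proof -
  have sN: "sets (N x) = sets K" if "x \<in> space M" for x
    using N that by (rule sets_kernel)
  have fN: "f \<in> borel_measurable (N x)" if "x \<in> space M" for x
    using f sN[OF that] by (simp cong: measurable_cong_sets)
  have m: "(\<lambda>x. \<integral>\<^sup>+y. g y \<partial>N x) \<in> borel_measurable M" if "g \<in> borel_measurable K" for g
    by (rule measurable_compose[OF N nn_integral_measurable_subprob_algebra[OF that]])
  have bound: "(\<integral>\<^sup>+x. \<integral>\<^sup>+y. ennreal \<bar>f y\<bar> \<partial>N x \<partial>M) < \<infinity>"
    using int f by (simp add: integrable_iff_bounded nn_integral_bind[OF _ N])
  have "(\<integral>\<^sup>+x. ennreal (norm (\<integral>y. f y \<partial>N x)) \<partial>M) \<le> (\<integral>\<^sup>+x. \<integral>\<^sup>+y. ennreal \<bar>f y\<bar> \<partial>N x \<partial>M)"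
  proof (rule nn_integral_mono)
    fix x
    \<comment> \<open>This holds at every \<open>x\<close>: where \<open>f\<close> is not integrable
      under \<open>N x\<close>, the integral has the default value 0.\<close>
    show "ennreal (norm (\<integral>y. f y \<partial>N x)) \<le> (\<integral>\<^sup>+y. ennreal \<bar>f y\<bar> \<partial>N x)"
      using integral_norm_bound_ennreal[of "N x" f] not_integrable_integral_eq[of "N x" f]
      by (cases "integrable (N x) f") auto
  qed
  then show int': "integrable M (\<lambda>x. \<integral>y. f y \<partial>N x)"
    using bound measurable_compose[OF N integral_measurable_subprob_algebra[OF f]]
    by (auto simp: integrable_iff_bounded)
  have fin: "(\<integral>\<^sup>+x. \<integral>\<^sup>+y. ennreal (g y) \<partial>N x \<partial>M) < \<infinity>" if "\<And>y. g y \<le> \<bar>f y\<bar>" for g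
    by (intro le_less_trans[OF nn_integral_mono[OF nn_integral_mono] bound] ennreal_leI that)
  \<comment> \<open>\<open>enn2real\<close> sends \<infinity> to 0, which changes \<open>u\<close>
    only on a null set because its integral is finite.\<close>
  have int_enn: "integrable M (\<lambda>x. enn2real (u x)) \<and> (\<integral>x. enn2real (u x) \<partial>M) = enn2real (\<integral>\<^sup>+x. u x \<partial>M)"
    if "u \<in> borel_measurable M" "(\<integral>\<^sup>+x. u x \<partial>M) < \<infinity>" for u
  proof -
    have "AE x in M. u x \<noteq> \<infinity>"
      using that by (intro nn_integral_PInf_AE) auto
    then have *: "(\<integral>\<^sup>+x. ennreal (enn2real (u x)) \<partial>M) = (\<integral>\<^sup>+x. u x \<partial>M)"
      by (intro nn_integral_cong_AE) (auto simp: less_top)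
    moreover have "integrable M (\<lambda>x. enn2real (u x))"
      using that * by (intro integrableI_nonneg) auto
    ultimately show ?thesis using that
      by (simp add: integral_eq_nn_integral)
  qed
  \<comment> \<open>The inner integral is the difference of its two parts only where
    \<open>f\<close> is integrable under \<open>N x\<close>; the finite iterated integral guarantees
    this almost everywhere.\<close>
  have "AE x in M. (\<integral>\<^sup>+y. ennreal \<bar>f y\<bar> \<partial>N x) \<noteq> \<infinity>"
    using bound f by (intro nn_integral_PInf_AE m) auto
  then have "AE x in M. (\<integral>y. f y \<partial>N x) =
      enn2real (\<integral>\<^sup>+y. ennreal (f y) \<partial>N x) - enn2real (\<integral>\<^sup>+y. ennreal (- f y) \<partial>N x)"
    using AE_space
  proof eventually_elim
    case (elim x)
    then have "integrable (N x) f"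
      using fN by (auto simp: integrable_iff_bounded less_top)
    then show ?case by (rule real_lebesgue_integral_def)
  qed
  then have "(\<integral>x. \<integral>y. f y \<partial>N x \<partial>M) = (\<integral>x. enn2real (\<integral>\<^sup>+y. ennreal (f y) \<partial>N x) - enn2real (\<integral>\<^sup>+y. ennreal (- f y) \<partial>N x) \<partial>M)"
    using f by (intro integral_cong_AE borel_measurable_diff borel_measurable_enn2real m
      borel_measurable_integrable[OF int']) auto
  also have "\<dots> = enn2real (\<integral>\<^sup>+x. \<integral>\<^sup>+y. ennreal (f y) \<partial>N x \<partial>M) - enn2real (\<integral>\<^sup>+x. \<integral>\<^sup>+y. ennreal (- f y) \<partial>N x \<partial>M)"
    using int_enn[OF m fin, of f] int_enn[OF m fin, of "\<lambda>y. - f y"] f by simp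
  also have "\<dots> = (\<integral>y. f y \<partial>(M \<bind> N))"
    using int f by (simp add: real_lebesgue_integral_def nn_integral_bind[OF _ N])
  finally show "(\<integral>y. f y \<partial>(M \<bind> N)) = (\<integral>x. \<integral>y. f y \<partial>N x \<partial>M)" by simp
qed

text \<open>On a rectangle the mass of the product kernel factorises and Tonelli separates the
  integrals; rectangles determine a product of probability measures.\<close>

lemma bind_pair_measure:
  assumes k: "k \<in> space (prob_algebra M)" and l: "l \<in> space (prob_algebra N)"
    and A: "A \<in> M \<rightarrow>\<^sub>M prob_algebra M'" and B: "B \<in> N \<rightarrow>\<^sub>M prob_algebra N'"
  shows "(k \<Otimes>\<^sub>M l) \<bind> (\<lambda>(x, y). A x \<Otimes>\<^sub>M B y) = (k \<bind> A) \<Otimes>\<^sub>M (l \<bind> B)"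
proof -
  have sk: "sets k = sets M" "sets l = sets N" and pk: "prob_space k" "prob_space l"
    using k l by (auto simp: space_prob_algebra)
  interpret k: prob_space k by fact
  interpret l: prob_space l by fact
  have kl: "k \<Otimes>\<^sub>M l \<in> space (prob_algebra (M \<Otimes>\<^sub>M N))"
    using sk pk by (auto simp: space_prob_algebra prob_space_pair cong: sets_pair_measure_cong)
  note [measurable] = A B
  have AB: "(\<lambda>(x, y). A x \<Otimes>\<^sub>M B y) \<in> M \<Otimes>\<^sub>M N \<rightarrow>\<^sub>M prob_algebra (M' \<Otimes>\<^sub>M N')"
    by measurable
  have sets: "sets (k \<bind> A) = sets M'" "sets (l \<bind> B) = sets N'"
    by (rule sets_bind'[OF k A], rule sets_bind'[OF l B])
  have prob: "prob_space (k \<bind> A)" "prob_space (l \<bind> B)"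
    by (rule prob_space_bind'[OF k A], rule prob_space_bind'[OF l B])
  interpret kA: prob_space "k \<bind> A" by fact
  interpret lB: prob_space "l \<bind> B" by fact
  show ?thesis
  proof (rule pair_measure_eqI[symmetric])
    show "sets ((k \<bind> A) \<Otimes>\<^sub>M (l \<bind> B)) = sets ((k \<Otimes>\<^sub>M l) \<bind> (\<lambda>(x, y). A x \<Otimes>\<^sub>M B y))"
      using sets_bind'[OF kl AB] sets by (simp cong: sets_pair_measure_cong)
    fix E F assume "E \<in> sets (k \<bind> A)" "F \<in> sets (l \<bind> B)"
    then have [measurable]: "E \<in> sets M'" "F \<in> sets N'" using sets by auto
    have [measurable]: "A \<in> M \<rightarrow>\<^sub>M subprob_algebra M'" "B \<in> N \<rightarrow>\<^sub>M subprob_algebra N'"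
      using A B by (auto intro: measurable_prob_algebraD)
    have mE: "(\<lambda>x. emeasure (A x) E) \<in> borel_measurable k"
      using sk by (simp cong: measurable_cong_sets)
    have mF: "(\<lambda>y. emeasure (B y) F) \<in> borel_measurable l"
      using sk by (simp cong: measurable_cong_sets)
    have sp: "space k = space M" "space l = space N" using sk by (auto dest: sets_eq_imp_space_eq)
    have "emeasure ((k \<Otimes>\<^sub>M l) \<bind> (\<lambda>(x, y). A x \<Otimes>\<^sub>M B y)) (E \<times> F) =
        (\<integral>\<^sup>+z. emeasure (case z of (x, y) \<Rightarrow> A x \<Otimes>\<^sub>M B y) (E \<times> F) \<partial>(k \<Otimes>\<^sub>M l))"
      by (rule emeasure_bind_prob_algebra[OF kl AB]) simp
    also have "\<dots> = (\<integral>\<^sup>+z. emeasure (A (fst z)) E * emeasure (B (snd z)) F \<partial>(k \<Otimes>\<^sub>M l))"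
    proof (rule nn_integral_cong)
      fix z assume "z \<in> space (k \<Otimes>\<^sub>M l)"
      then have z: "fst z \<in> space M" "snd z \<in> space N" using sp by (auto simp: space_pair_measure)
      then have AB_space: "sets (A (fst z)) = sets M'" "sets (B (snd z)) = sets N'" "prob_space (B (snd z))"
        using measurable_space[OF A] measurable_space[OF B] by (auto simp: space_prob_algebra)
      interpret b: prob_space "B (snd z)" by fact
      from AB_space show "emeasure (case z of (x, y) \<Rightarrow> A x \<Otimes>\<^sub>M B y) (E \<times> F) = emeasure (A (fst z)) E * emeasure (B (snd z)) F"
        by (simp add: case_prod_beta b.emeasure_pair_measure_Times)
    qed
    also have "\<dots> = (\<integral>\<^sup>+x. \<integral>\<^sup>+y. emeasure (A x) E * emeasure (B y) F \<partial>l \<partial>k)"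
      using mE mF by (subst l.nn_integral_fst[symmetric]) auto
    also have "\<dots> = emeasure (k \<bind> A) E * emeasure (l \<bind> B) F"
      using mE mF emeasure_bind_prob_algebra[OF k A, of E] emeasure_bind_prob_algebra[OF l B, of F]
      by (simp add: nn_integral_cmult nn_integral_multc)
    finally show "emeasure (k \<bind> A) E * emeasure (l \<bind> B) F =
        emeasure ((k \<Otimes>\<^sub>M l) \<bind> (\<lambda>(x, y). A x \<Otimes>\<^sub>M B y)) (E \<times> F)" by simp
  qed unfold_locales
qed

section \<open>Iterates of \<open>P\<close>, stationarity, and products of kernels\<close>

locale poisson2 =
  fixes M \<mu> :: "'a measure" and P :: "'a \<Rightarrow> 'a measure"
    and V W :: "'a \<times> 'a \<Rightarrow> real" and c :: real
  assumes P: "P \<in> M \<rightarrow>\<^sub>M prob_algebra M"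
    and invariant: "invariant_distribution M P \<mu>"
    and V_measurable [measurable]: "V \<in> borel_measurable (M \<Otimes>\<^sub>M M)"
    and W_measurable [measurable]: "W \<in> borel_measurable (M \<Otimes>\<^sub>M M)"
    and V_ge_1: "\<And>z. z \<in> space (M \<Otimes>\<^sub>M M) \<Longrightarrow> 1 \<le> V z"
    and V_le_W: "\<And>z. z \<in> space (M \<Otimes>\<^sub>M M) \<Longrightarrow> V z \<le> W z"
    and c_nonneg: "0 \<le> c"
    and condition_C: "\<And>x y. x \<in> space M \<Longrightarrow> y \<in> space M \<Longrightarrow>
      (\<Sum>k. \<Sum>l. signed_norm (M \<Otimes>\<^sub>M M) V (centered_pair M P \<mu> k l x y)) \<le> ennreal (c * W (x, y))"
begin

lemma \<mu>: "\<mu> \<in> space (prob_algebra M)" "\<mu> \<bind> P = \<mu>" "prob_space \<mu>" "sets \<mu> = sets M"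
  using invariant by (auto simp: invariant_distribution_def space_prob_algebra)

text \<open>Time \<open>\<infinity>\<close> stands for stationarity, so that the semigroup property covers the invariance of \<open>\<mu>\<close>.\<close>

definition ker :: "enat \<Rightarrow> 'a \<Rightarrow> 'a measure" where
  "ker n x = (case n of enat k \<Rightarrow> kernel_power M P k x | \<infinity> \<Rightarrow> \<mu>)"

lemma ker_simps[simp]: "ker (enat k) x = kernel_power M P k x" "ker \<infinity> x = \<mu>"
  by (simp_all add: ker_def)

lemma ker_enat: "ker (enat k) = kernel_power M P k"
  by (simp add: fun_eq_iff)

lemma kernel_power_measurable: "kernel_power M P k \<in> M \<rightarrow>\<^sub>M prob_algebra M"
  by (induction k) (auto intro: measurable_bind_prob_space[OF _ P])

lemma ker_measurable [measurable]: "ker n \<in> M \<rightarrow>\<^sub>M prob_algebra M"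
proof (cases n)
  case (enat k)
  then show ?thesis using kernel_power_measurable[of k] by (simp add: ker_enat)
next
  case infinity
  have "ker \<infinity> = (\<lambda>_. \<mu>)" by (simp add: fun_eq_iff)
  then show ?thesis using \<mu> infinity by simp
qed

lemma ker_space:
  assumes "x \<in> space M"
  shows "ker n x \<in> space (prob_algebra M)" "prob_space (ker n x)" "finite_measure (ker n x)"
    "sets (ker n x) = sets M" "space (ker n x) = space M"
  using measurable_space[OF ker_measurable assms, of n]
  by (auto simp: space_prob_algebra prob_space_def dest: sets_eq_imp_space_eq)

text \<open>For finite times this is Chapman-Kolmogorov. The case \<open>n = \<infinity>\<close>
  says that a constant kernel forgets its start, and \<open>m = \<infinity>\<close> is where
  invariance enters.\<close>

lemma bind_ker:
  assumes x: "x \<in> space M"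
  shows "ker m x \<bind> ker n = ker (m + n) x"
proof (cases n)
  case infinity
  have "ker m x \<bind> (\<lambda>_. \<mu>) = \<mu>"
    using x \<mu> by (intro bind_const' ker_space prob_space_imp_subprob_space) auto
  moreover have "ker \<infinity> = (\<lambda>_. \<mu>)" by (simp add: fun_eq_iff)
  ultimately show ?thesis by (simp add: infinity)
next
  case (enat k)
  have "ker m x \<bind> kernel_power M P k = ker (m + enat k) x"
  proof (induction k)
    case 0
    show ?case using ker_space(4)[OF x, of m] by (simp add: bind_return'' zero_enat_def[symmetric])
  next
    case (Suc k)
    have "kernel_power M P k \<in> ker m x \<rightarrow>\<^sub>M subprob_algebra M"
      using measurable_prob_algebraD[OF kernel_power_measurable[of k]] ker_space(4)[OF x, of m]
      by (simp cong: measurable_cong_sets)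
    then have "ker m x \<bind> kernel_power M P (Suc k) = (ker m x \<bind> kernel_power M P k) \<bind> P"
      using P by (simp add: bind_assoc[where N = M and R = M] measurable_prob_algebraD)
    also have "\<dots> = ker (m + enat k) x \<bind> P" by (simp only: Suc)
    also have "\<dots> = ker (m + enat (Suc k)) x"
      using \<mu> by (cases m) auto
    finally show ?case .
  qed
  then show ?thesis by (simp add: enat ker_enat)
qed

definition ker2 :: "enat \<Rightarrow> enat \<Rightarrow> 'a \<times> 'a \<Rightarrow> ('a \<times> 'a) measure" where
  "ker2 m n = (\<lambda>(x, y). ker m x \<Otimes>\<^sub>M ker n y)"

lemma ker2_measurable [measurable]: "ker2 m n \<in> M \<Otimes>\<^sub>M M \<rightarrow>\<^sub>M prob_algebra (M \<Otimes>\<^sub>M M)"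
  unfolding ker2_def by measurable

lemma ker2_space:
  assumes "z \<in> space (M \<Otimes>\<^sub>M M)"
  shows "ker2 m n z \<in> space (prob_algebra (M \<Otimes>\<^sub>M M))" "prob_space (ker2 m n z)"
    "sets (ker2 m n z) = sets (M \<Otimes>\<^sub>M M)" "space (ker2 m n z) = space (M \<Otimes>\<^sub>M M)"
  using measurable_space[OF ker2_measurable assms, of m n]
  by (auto simp: space_prob_algebra dest: sets_eq_imp_space_eq)

lemma bind_ker2:
  assumes "z \<in> space (M \<Otimes>\<^sub>M M)"
  shows "ker2 m n z \<bind> ker2 m' n' = ker2 (m + m') (n + n') z"
  using assms unfolding ker2_def
  by (auto simp: space_pair_measure bind_pair_measure[OF ker_space(1) ker_space(1) ker_measurable ker_measurable]
      bind_ker)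

lemma nn_integral_ker2:
  assumes "x \<in> space M" "y \<in> space M" "f \<in> borel_measurable (M \<Otimes>\<^sub>M M)"
  shows "(\<integral>\<^sup>+z. f z \<partial>ker2 m n (x, y)) = (\<integral>\<^sup>+u. \<integral>\<^sup>+v. f (u, v) \<partial>ker n y \<partial>ker m x)"
proof -
  interpret prob_space "ker n y" by (rule ker_space) fact
  have "f \<in> borel_measurable (ker m x \<Otimes>\<^sub>M ker n y)"
    using assms by (simp add: ker_space cong: measurable_cong_sets sets_pair_measure_cong)
  then show ?thesis by (simp add: ker2_def nn_integral_fst)
qed

lemma centered_pair_norm_finite:
  assumes "x \<in> space M" "y \<in> space M"
  shows "signed_norm (M \<Otimes>\<^sub>M M) V (centered_pair M P \<mu> k l x y) < \<infinity>"
proof -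
  have "signed_norm (M \<Otimes>\<^sub>M M) V (centered_pair M P \<mu> k l x y)
      \<le> (\<Sum>l. signed_norm (M \<Otimes>\<^sub>M M) V (centered_pair M P \<mu> k l x y))"
    using sum_le_suminf[of "\<lambda>l. signed_norm (M \<Otimes>\<^sub>M M) V (centered_pair M P \<mu> k l x y)" "{l}"] by simp
  also have "\<dots> \<le> (\<Sum>k. \<Sum>l. signed_norm (M \<Otimes>\<^sub>M M) V (centered_pair M P \<mu> k l x y))"
    using sum_le_suminf[of "\<lambda>k. \<Sum>l. signed_norm (M \<Otimes>\<^sub>M M) V (centered_pair M P \<mu> k l x y)" "{k}"] by simp
  also have "\<dots> < \<infinity>"
    using condition_C[OF assms] by (auto intro: le_less_trans)
  finally show ?thesis .
qed

lemma jordan_ker: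
  assumes "x \<in> space M"
  obtains p n Y where "jordan_pair M (ker m x) \<mu> p n Y"
  using assms ker_space[OF assms, of m] \<mu>
  by (elim jordan_pair_exists[of "ker m x" \<mu> M, rotated 4]) (auto simp: prob_space_def)

lemma jordan_pair_prod_ker:
  assumes "jordan_pair M (ker (enat k) x) \<mu> p1 n1 Y1" "jordan_pair M (ker (enat l) y) \<mu> p2 n2 Y2"
  shows "jordan_pair_prod M (kernel_power M P k x) \<mu> p1 n1 Y1 M (kernel_power M P l y) \<mu> p2 n2 Y2"
  using assms by (simp add: jordan_pair_prod_def)

text \<open>
  Condition C only controls centred kernels. A point \<open>x\<^sub>0\<close> whose Dirac measure differs from
  \<open>\<mu>\<close> gives access to \<open>\<mu>\<close> itself, and then to the kernels; if there is no such point,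
  then every kernel is a Dirac measure.
\<close>

lemma V_ker2_finite:
  assumes z: "z \<in> space (M \<Otimes>\<^sub>M M)"
  shows "(\<integral>\<^sup>+w. ennreal (V w) \<partial>ker2 m n z) < \<infinity>"
proof -
  obtain x y where xy: "z = (x, y)" "x \<in> space M" "y \<in> space M"
    using z by (auto simp: space_pair_measure)
  show ?thesis
  proof (cases "\<exists>x\<^sub>0\<in>space M. return M x\<^sub>0 \<noteq> \<mu>")
    case False
    have ker: "ker m x = return M x" if x: "x \<in> space M" for m x
    proof (cases m)
      case (enat k)
      \<comment> \<open>Here every Dirac measure equals \<mu>, so invariance makes each of them a
        fixed point of \<open>P\<close>.\<close>
      have "kernel_power M P k x = return M x"
        using False x \<mu> by (induction k) auto
      then show ?thesis by (simp add: enat)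
    qed (use False x in auto)
    have "(\<integral>\<^sup>+w. ennreal (V w) \<partial>ker2 m n z) = (\<integral>\<^sup>+u. \<integral>\<^sup>+v. ennreal (V (u, v)) \<partial>return M y \<partial>return M x)"
      using xy by (simp add: nn_integral_ker2 ker)
    also have "\<dots> = (\<integral>\<^sup>+u. ennreal (V (u, y)) \<partial>return M x)"
      using xy by (intro nn_integral_cong nn_integral_return) auto
    also have "\<dots> = ennreal (V (x, y))"
      using xy by (intro nn_integral_return) auto
    finally have "(\<integral>\<^sup>+w. ennreal (V w) \<partial>ker2 m n z) = ennreal (V (x, y))" .
    then show ?thesis by simp
  next
    case True
    then obtain x\<^sub>0 where x0: "x\<^sub>0 \<in> space M" "return M x\<^sub>0 \<noteq> \<mu>" by auto
    \<comment> \<open>At time 0 the kernel is a Dirac measure, as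
      \<open>nn_integral_b_finite\<close> requires.\<close>
    obtain p\<^sub>0 n\<^sub>0 Y\<^sub>0 where J0: "jordan_pair M (ker (enat 0) x\<^sub>0) \<mu> p\<^sub>0 n\<^sub>0 Y\<^sub>0"
      using jordan_ker[OF x0(1)] .
    interpret J0: jordan_pair M "ker (enat 0) x\<^sub>0" \<mu> p\<^sub>0 n\<^sub>0 Y\<^sub>0 by fact
    \<comment> \<open>A single summand of condition C controls \<open>V\<close> under each of the
      four products of Jordan parts.\<close>
    have prod_fin: "(\<integral>\<^sup>+u. \<integral>\<^sup>+v. ennreal (V (u, v)) \<partial>q \<partial>p1) < \<infinity>" "(\<integral>\<^sup>+u. \<integral>\<^sup>+v. ennreal (V (u, v)) \<partial>q \<partial>n1) < \<infinity>"
      if J1: "jordan_pair M (ker (enat k) x) \<mu> p1 n1 Y1" and J2: "jordan_pair M (ker (enat l) y) \<mu> p2 n2 Y2"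
        and xy: "x \<in> space M" "y \<in> space M" and q: "q \<in> {p2, n2}" for k l x y p1 n1 Y1 p2 n2 Y2 q
    proof -
      interpret J: jordan_pair_prod M "kernel_power M P k x" \<mu> p1 n1 Y1 M "kernel_power M P l y" \<mu> p2 n2 Y2
        using J1 J2 by (rule jordan_pair_prod_ker)
      have "(\<integral>\<^sup>+z. ennreal (V z) \<partial>total_variation (M \<Otimes>\<^sub>M M) J.R) < \<infinity>"
        using centered_pair_norm_finite[OF xy] by (simp add: signed_norm_def centered_pair_def)
      then have fin: "(\<integral>\<^sup>+z. ennreal (V z) \<partial>(r \<Otimes>\<^sub>M q)) < \<infinity>" if "r \<in> {p1, n1}" for r
        using that q by (auto simp: J.nn_integral_total_variation_signed_pair ennreal_add_less_top)
      interpret q: finite_measure q using q J.J2.fin by auto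
      have "V \<in> borel_measurable (r \<Otimes>\<^sub>M q)" if "r \<in> {p1, n1}" for r
        using that q J.sets_prod[of r q] V_measurable by (auto cong: measurable_cong_sets)
      then show "(\<integral>\<^sup>+u. \<integral>\<^sup>+v. ennreal (V (u, v)) \<partial>q \<partial>p1) < \<infinity>" "(\<integral>\<^sup>+u. \<integral>\<^sup>+v. ennreal (V (u, v)) \<partial>q \<partial>n1) < \<infinity>"
        using fin by (simp_all add: q.nn_integral_fst[where f = "\<lambda>z. ennreal (V z)"])
    qed
    \<comment> \<open>The passage from parts to kernels in one coordinate: \<open>x\<^sub>0\<close>
      gives \<mu>, and \<mu> gives \<open>ker m x\<close>. It is used for the first coordinate with
      a Jordan part held fixed in the second, and afterwards for the second coordinate with the
      whole kernel in the first.\<close>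
    have ker_fin: "(\<integral>\<^sup>+u. f u \<partial>ker m x) < \<infinity>"
      if f: "f \<in> borel_measurable M" and x: "x \<in> space M"
        and fin: "\<And>k x p n Y. x \<in> space M \<Longrightarrow> jordan_pair M (ker (enat k) x) \<mu> p n Y \<Longrightarrow>
          (\<integral>\<^sup>+u. f u \<partial>p) < \<infinity> \<and> (\<integral>\<^sup>+u. f u \<partial>n) < \<infinity>" for f m x
    proof -
      have mu: "(\<integral>\<^sup>+u. f u \<partial>\<mu>) < \<infinity>"
        using x0 \<mu> f fin[OF x0(1) J0] by (intro J0.nn_integral_b_finite[where x = x\<^sub>0]) auto
      show ?thesis
      proof (cases m)
        case (enat k)
        obtain p n Y where J: "jordan_pair M (ker (enat k) x) \<mu> p n Y"
          using jordan_ker[OF x] .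
        show ?thesis
          using jordan_pair.nn_integral_a_finite[OF J f _ mu] fin[OF x J] enat by auto
      qed (use mu in simp)
    qed
    have meas: "(\<lambda>u. \<integral>\<^sup>+v. ennreal (V (u, v)) \<partial>q) \<in> borel_measurable M"
      if "finite_measure q" "sets q = sets M" for q
    proof -
      interpret finite_measure q by fact
      have "V \<in> borel_measurable (M \<Otimes>\<^sub>M q)"
        using that V_measurable by (simp cong: measurable_cong_sets sets_pair_measure_cong)
      then show ?thesis by (intro borel_measurable_nn_integral_fst) auto
    qed
    have swap: "(\<integral>\<^sup>+v. \<integral>\<^sup>+u. ennreal (V (u, v)) \<partial>r \<partial>q) = (\<integral>\<^sup>+u. \<integral>\<^sup>+v. ennreal (V (u, v)) \<partial>q \<partial>r)"
      if "finite_measure q" "sets q = sets M" "finite_measure r" "sets r = sets M" for q r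
    proof -
      have "V \<in> borel_measurable (r \<Otimes>\<^sub>M q)"
        using that V_measurable by (simp cong: measurable_cong_sets sets_pair_measure_cong)
      then show ?thesis
        using that by (intro pair_sigma_finite.Fubini[of r q "\<lambda>z. ennreal (V z)"] pair_sigma_finiteI) auto
    qed
    have half: "(\<integral>\<^sup>+v. \<integral>\<^sup>+u. ennreal (V (u, v)) \<partial>ker m x \<partial>q) < \<infinity>"
      if J2: "jordan_pair M (ker (enat l) y) \<mu> p2 n2 Y2" "y \<in> space M" and q: "q \<in> {p2, n2}"
      for l y p2 n2 Y2 q
    proof -
      interpret J2: jordan_pair M "ker (enat l) y" \<mu> p2 n2 Y2 by fact
      have q': "finite_measure q" "sets q = sets M" using q J2.fin J2.sets by auto
      have "(\<integral>\<^sup>+u. \<integral>\<^sup>+v. ennreal (V (u, v)) \<partial>q \<partial>ker m x) < \<infinity>"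
        using prod_fin[OF _ J2(1) _ J2(2) q] by (intro ker_fin meas q' xy) auto
      then show ?thesis
        using xy q' by (simp add: swap ker_space)
    qed
    have "(\<integral>\<^sup>+v. \<integral>\<^sup>+u. ennreal (V (u, v)) \<partial>ker m x \<partial>ker n y) < \<infinity>"
    proof (rule ker_fin)
      interpret prob_space "ker m x" using xy by (simp add: ker_space)
      have "(\<lambda>(v, u). V (u, v)) \<in> borel_measurable (M \<Otimes>\<^sub>M ker m x)"
        using ker_space[OF xy(2), of m] by (simp cong: measurable_cong_sets sets_pair_measure_cong)
      then show "(\<lambda>v. \<integral>\<^sup>+u. ennreal (V (u, v)) \<partial>ker m x) \<in> borel_measurable M"
        by (intro borel_measurable_nn_integral) (auto simp: case_prod_beta)
    qed (use xy half in auto)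
    then show ?thesis
      using xy by (simp add: nn_integral_ker2 swap ker_space)
  qed
qed

end

subsection \<open>Double series\<close>

lemma infsum_nat_eq_suminf:
  fixes f :: "nat \<Rightarrow> real"
  assumes "f summable_on UNIV"
  shows "infsum f UNIV = suminf f"
  by (rule sums_unique[OF has_sum_imp_sums[OF has_sum_infsum[OF assms]]])

lemma summable_on_pairD:
  fixes f :: "nat \<times> nat \<Rightarrow> real"
  assumes "f summable_on UNIV"
  shows "(\<lambda>m. f (n, m)) summable_on UNIV" "(\<lambda>n. \<Sum>m. f (n, m)) summable_on UNIV"
    "(\<Sum>n. \<Sum>m. f (n, m)) = infsum f UNIV"
proof -
  have f: "f summable_on (UNIV \<times> UNIV)" using assms by simp
  show 1: "(\<lambda>m. f (n, m)) summable_on UNIV" for n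
    by (rule summable_on_SigmaD1[where f = "\<lambda>n m. f (n, m)" and A = UNIV]) (use f in auto)
  have 2: "(\<lambda>n. infsum (\<lambda>m. f (n, m)) UNIV) summable_on UNIV"
    by (rule summable_on_Sigma_banach[where f = "\<lambda>n m. f (n, m)"]) (use f in simp)
  then show 3: "(\<lambda>n. \<Sum>m. f (n, m)) summable_on UNIV"
    using 1 by (simp add: infsum_nat_eq_suminf)
  show "(\<Sum>n. \<Sum>m. f (n, m)) = infsum f UNIV"
    using infsum_Sigma_banach[OF f] infsum_nat_eq_suminf[OF 3] 1
    by (simp add: infsum_nat_eq_suminf)
qed

text \<open>The resolvent is an iterated sum and its well-definedness an unconditional one, while
  convergence theorems want a sequence of partial sums; the pairing function links the
  three.\<close>

lemma infsum_eq_suminf_prod_decode: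
  fixes f :: "nat \<times> nat \<Rightarrow> real"
  assumes "f summable_on UNIV"
  shows "infsum f UNIV = (\<Sum>i. f (prod_decode i))"
  using assms infsum_nat_eq_suminf[of "\<lambda>i. f (prod_decode i)"]
  by (simp add: summable_on_reindex_bij_betw[OF bij_prod_decode] infsum_reindex_bij_betw[OF bij_prod_decode])

lemma summable_on_prod_decode:
  fixes f :: "nat \<times> nat \<Rightarrow> real"
  assumes "summable (\<lambda>i. \<bar>f (prod_decode i)\<bar>)"
  shows "f summable_on UNIV"
  using norm_summable_imp_summable_on[of "\<lambda>i. f (prod_decode i)"] assms
  by (simp add: summable_on_reindex_bij_betw[OF bij_prod_decode])

text \<open>Subtracting the shift in the first index leaves row 0, for \<open>f\<close> and for its
  shift in the second index alike. The difference of these two rows is the corner.\<close>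

lemma infsum_telescope_pair:
  fixes f :: "nat \<times> nat \<Rightarrow> real"
  assumes "f summable_on UNIV" "(\<lambda>(i, j). f (i, Suc j)) summable_on UNIV"
    "(\<lambda>(i, j). f (Suc i, j)) summable_on UNIV" "(\<lambda>(i, j). f (Suc i, Suc j)) summable_on UNIV"
  shows "infsum f UNIV - (\<Sum>\<^sub>\<infinity>(i, j). f (i, Suc j))
    - ((\<Sum>\<^sub>\<infinity>(i, j). f (Suc i, j)) - (\<Sum>\<^sub>\<infinity>(i, j). f (Suc i, Suc j))) = f (0, 0)"
proof -
  have step: "infsum g UNIV - (\<Sum>\<^sub>\<infinity>(i, j). g (Suc i, j)) = (\<Sum>j. g (0, j))"
    if "g summable_on UNIV" "(\<lambda>(i, j). g (Suc i, j)) summable_on UNIV" for g :: "nat \<times> nat \<Rightarrow> real"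
    using suminf_split_head[OF summable_on_imp_summable[OF summable_on_pairD(2)[OF that(1)]]]
      summable_on_pairD(3)[OF that(1)] summable_on_pairD(3)[OF that(2)]
    by simp
  have "(\<Sum>j. f (0, j)) - (\<Sum>j. f (0, Suc j)) = f (0, 0)"
    using suminf_split_head[OF summable_on_imp_summable[OF summable_on_pairD(1)[OF assms(1), of 0]]]
    by simp
  then show ?thesis
    using step[of f] step[of "\<lambda>(i, j). f (i, Suc j)"] assms by simp
qed

lemma suminf_ennreal_le_real:
  assumes "\<And>i. 0 \<le> f i" "(\<Sum>i. ennreal (f i)) \<le> ennreal B" "0 \<le> B"
  shows "summable f" "suminf f \<le> B"
proof -
  have "(\<Sum>i. ennreal (f i)) \<noteq> top"
    using assms(2) by (auto simp: top_unique)
  then show s: "summable f" by (rule summable_suminf_not_top[OF assms(1)])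
  show "suminf f \<le> B"
    using assms by (simp add: suminf_ennreal2 s)
qed

subsection \<open>The Poisson equation\<close>

context poisson2
begin

definition T :: "enat \<Rightarrow> enat \<Rightarrow> ('a \<times> 'a \<Rightarrow> real) \<Rightarrow> 'a \<times> 'a \<Rightarrow> real" where
  "T m n g z = (\<integral>w. g w \<partial>ker2 m n z)"

text \<open>An explicit real constant in place of the supremum norm, so that one and the same
  \<open>C\<close> passes linearly through all estimates.\<close>

definition dominated :: "('a \<times> 'a \<Rightarrow> real) \<Rightarrow> real \<Rightarrow> bool" where
  "dominated g C \<longleftrightarrow> g \<in> borel_measurable (M \<Otimes>\<^sub>M M) \<and> 0 \<le> C \<and>
    (\<forall>z\<in>space (M \<Otimes>\<^sub>M M). \<bar>g z\<bar> \<le> C * V z)"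

lemma dominatedD:
  assumes "dominated g C"
  shows "g \<in> borel_measurable (M \<Otimes>\<^sub>M M)" "0 \<le> C" "z \<in> space (M \<Otimes>\<^sub>M M) \<Longrightarrow> \<bar>g z\<bar> \<le> C * V z"
  using assms by (auto simp: dominated_def)

lemma nn_integral_dominated_le:
  assumes g: "dominated g C" and K: "sets K = sets (M \<Otimes>\<^sub>M M)"
  shows "(\<integral>\<^sup>+w. ennreal \<bar>g w\<bar> \<partial>K) \<le> ennreal C * (\<integral>\<^sup>+w. ennreal (V w) \<partial>K)"
proof -
  have "(\<integral>\<^sup>+w. ennreal \<bar>g w\<bar> \<partial>K) \<le> (\<integral>\<^sup>+w. ennreal C * ennreal (V w) \<partial>K)"
    using dominatedD[OF g] sets_eq_imp_space_eq[OF K] V_ge_1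
    by (intro nn_integral_mono) (auto simp flip: ennreal_mult' intro!: ennreal_leI)
  also have "\<dots> = ennreal C * (\<integral>\<^sup>+w. ennreal (V w) \<partial>K)"
    using K V_measurable by (intro nn_integral_cmult) (simp cong: measurable_cong_sets)
  finally show ?thesis .
qed

lemma dominated_integrable:
  assumes g: "dominated g C" and z: "z \<in> space (M \<Otimes>\<^sub>M M)"
  shows "integrable (ker2 m n z) g"
proof -
  have "(\<integral>\<^sup>+w. ennreal \<bar>g w\<bar> \<partial>ker2 m n z) \<le> ennreal C * (\<integral>\<^sup>+w. ennreal (V w) \<partial>ker2 m n z)"
    using g ker2_space(3)[OF z] by (rule nn_integral_dominated_le)
  also have "\<dots> < \<infinity>"
    using V_ker2_finite[OF z] by (simp add: ennreal_mult_less_top)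
  finally show ?thesis
    using dominatedD(1)[OF g] ker2_space(3)[OF z, of m n]
    by (simp add: integrable_iff_bounded cong: measurable_cong_sets)
qed

lemma T_measurable[measurable]:
  assumes "g \<in> borel_measurable (M \<Otimes>\<^sub>M M)"
  shows "T m n g \<in> borel_measurable (M \<Otimes>\<^sub>M M)"
  unfolding T_def
  by (rule measurable_compose[OF measurable_prob_algebraD[OF ker2_measurable]
      integral_measurable_subprob_algebra[OF assms]])

text \<open>Here finiteness of \<open>V\<close> under uncentred products pays off: \<open>g\<close>
  is integrable under the composed kernel, so the iterated integral may be merged, also at time
  \<infinity>.\<close>

lemma
  assumes g: "dominated g C" and z: "z \<in> space (M \<Otimes>\<^sub>M M)"
  shows integrable_T: "integrable (ker2 m n z) (T m' n' g)"
    and T_T: "T m n (T m' n' g) z = T (m + m') (n + n') g z"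
proof -
  have N: "ker2 m' n' \<in> ker2 m n z \<rightarrow>\<^sub>M subprob_algebra (M \<Otimes>\<^sub>M M)"
    using measurable_prob_algebraD[OF ker2_measurable] ker2_space(3)[OF z, of m n]
    by (simp cong: measurable_cong_sets)
  have int: "integrable (ker2 m n z \<bind> ker2 m' n') g"
    unfolding bind_ker2[OF z] using g z by (rule dominated_integrable)
  show "integrable (ker2 m n z) (T m' n' g)"
    unfolding T_def by (rule integrable_integral_kernel[OF dominatedD(1)[OF g] N int])
  show "T m n (T m' n' g) z = T (m + m') (n + n') g z"
    unfolding T_def by (subst integral_bind_integrable[OF dominatedD(1)[OF g] N int, symmetric])
      (simp add: bind_ker2[OF z])
qed

text \<open>The integral of \<open>g\<close> with respect to \<^const>\<open>centered_pair\<close>.\<close>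

definition F :: "nat \<Rightarrow> nat \<Rightarrow> ('a \<times> 'a \<Rightarrow> real) \<Rightarrow> 'a \<times> 'a \<Rightarrow> real" where
  "F k l g z = T k l g z - T k \<infinity> g z - T \<infinity> l g z + T \<infinity> \<infinity> g z"

lemma F_measurable[measurable]:
  assumes [measurable]: "g \<in> borel_measurable (M \<Otimes>\<^sub>M M)"
  shows "F k l g \<in> borel_measurable (M \<Otimes>\<^sub>M M)"
  unfolding F_def by measurable

text \<open>A shift in time moves finite indices and leaves \<infinity> in place, so that
  \<open>P^k - \<mu>\<close> becomes \<open>P^(k+a) - \<mu>\<close> in each coordinate.\<close>

lemma T_F:
  fixes a b :: nat
  assumes g: "dominated g C" and z: "z \<in> space (M \<Otimes>\<^sub>M M)"
  shows "T a b (F k l g) z = F (k + a) (l + b) g z"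
proof -
  have "T a b (F k l g) z = T a b (T k l g) z - T a b (T k \<infinity> g) z - T a b (T \<infinity> l g) z + T a b (T \<infinity> \<infinity> g) z"
    unfolding F_def T_def[of a b] using integrable_T[OF g z] by simp
  then show ?thesis by (simp add: T_T[OF g z] F_def add.commute)
qed

lemma F_T:
  fixes a b :: nat
  assumes g: "dominated g C" and z: "z \<in> space (M \<Otimes>\<^sub>M M)"
  shows "F k l (T a b g) z = F (k + a) (l + b) g z"
  by (simp add: F_def T_T[OF g z])

abbreviation "cp k l z \<equiv> centered_pair M P \<mu> k l (fst z) (snd z)"
abbreviation "pos k l z \<equiv> pos_part (M \<Otimes>\<^sub>M M) (cp k l z)"
abbreviation "neg k l z \<equiv> neg_part (M \<Otimes>\<^sub>M M) (cp k l z)"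
abbreviation "cpn k l z \<equiv> signed_norm (M \<Otimes>\<^sub>M M) V (cp k l z)"

text \<open>The bridge from set functions to integrals: on one side the Jordan parts that condition
  C bounds, on the other the expansion \<open>F\<close> on which kernels act by shifts.\<close>

lemma centered_pair_parts:
  assumes z: "z \<in> space (M \<Otimes>\<^sub>M M)"
  shows "finite_measure (pos k l z)" "finite_measure (neg k l z)"
    and "E \<in> sets (M \<Otimes>\<^sub>M M) \<Longrightarrow> cp k l z E = measure (pos k l z) E - measure (neg k l z) E"
    and "dominated g C \<Longrightarrow> integrable (pos k l z) g"
    and "dominated g C \<Longrightarrow> integrable (neg k l z) g"
    and "dominated g C \<Longrightarrow> F k l g z = (\<integral>w. g w \<partial>pos k l z) - (\<integral>w. g w \<partial>neg k l z)"
proof -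
  obtain x y where xy: "z = (x, y)" "x \<in> space M" "y \<in> space M"
    using z by (auto simp: space_pair_measure)
  obtain p1 n1 Y1 where J1: "jordan_pair M (ker (enat k) x) \<mu> p1 n1 Y1"
    using jordan_ker[OF xy(2)] .
  obtain p2 n2 Y2 where J2: "jordan_pair M (ker (enat l) y) \<mu> p2 n2 Y2"
    using jordan_ker[OF xy(3)] .
  interpret J: jordan_pair_prod M "kernel_power M P k x" \<mu> p1 n1 Y1 M "kernel_power M P l y" \<mu> p2 n2 Y2
    using J1 J2 by (rule jordan_pair_prod_ker)
  have cp: "cp k l z = J.R" by (simp add: xy centered_pair_def)
  show "finite_measure (pos k l z)" "finite_measure (neg k l z)"
    unfolding cp by (rule J.finite_signed_pair_parts)+
  show "E \<in> sets (M \<Otimes>\<^sub>M M) \<Longrightarrow> cp k l z E = measure (pos k l z) E - measure (neg k l z) E"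
    unfolding cp by (rule J.signed_pair_eq_parts)
  assume g: "dominated g C"
  have ints: "integrable (kernel_power M P k x \<Otimes>\<^sub>M kernel_power M P l y) g"
    "integrable (kernel_power M P k x \<Otimes>\<^sub>M \<mu>) g"
    "integrable (\<mu> \<Otimes>\<^sub>M kernel_power M P l y) g" "integrable (\<mu> \<Otimes>\<^sub>M \<mu>) g"
    using dominated_integrable[OF g z, of k l] dominated_integrable[OF g z, of k \<infinity>]
      dominated_integrable[OF g z, of \<infinity> l] dominated_integrable[OF g z, of \<infinity> \<infinity>]
    by (simp_all add: ker2_def xy)
  show "integrable (pos k l z) g" "integrable (neg k l z) g"
    unfolding cp by (rule J.signed_integral_signed_pair(2,3)[OF ints])+
  show "F k l g z = (\<integral>w. g w \<partial>pos k l z) - (\<integral>w. g w \<partial>neg k l z)"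
    using J.signed_integral_signed_pair(1)[OF ints]
    unfolding signed_integral_def cp[symmetric] by (simp add: F_def T_def ker2_def xy)
qed

lemma parts_le_norm:
  assumes g: "dominated g C"
  shows "(\<integral>\<^sup>+w. ennreal \<bar>g w\<bar> \<partial>pos k l z) + (\<integral>\<^sup>+w. ennreal \<bar>g w\<bar> \<partial>neg k l z) \<le> ennreal C * cpn k l z"
proof -
  have "(\<integral>\<^sup>+w. ennreal \<bar>g w\<bar> \<partial>pos k l z) + (\<integral>\<^sup>+w. ennreal \<bar>g w\<bar> \<partial>neg k l z)
      = (\<integral>\<^sup>+w. ennreal \<bar>g w\<bar> \<partial>total_variation (M \<Otimes>\<^sub>M M) (cp k l z))"
    using dominatedD(1)[OF g] by (simp add: nn_integral_total_variation)
  also have "\<dots> \<le> ennreal C * cpn k l z"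
    unfolding signed_norm_def using g by (rule nn_integral_dominated_le) (simp add: total_variation_def)
  finally show ?thesis .
qed

lemma F_bound:
  assumes g: "dominated g C" and z: "z \<in> space (M \<Otimes>\<^sub>M M)"
  shows "ennreal \<bar>F k l g z\<bar> \<le> ennreal C * cpn k l z"
proof -
  note int = centered_pair_parts(4,5)[OF z g, of k l]
  have "ennreal \<bar>F k l g z\<bar> \<le> ennreal (\<bar>\<integral>w. g w \<partial>pos k l z\<bar> + \<bar>\<integral>w. g w \<partial>neg k l z\<bar>)"
    unfolding centered_pair_parts(6)[OF z g] by (intro ennreal_leI) linarith
  also have "\<dots> \<le> (\<integral>\<^sup>+w. ennreal \<bar>g w\<bar> \<partial>pos k l z) + (\<integral>\<^sup>+w. ennreal \<bar>g w\<bar> \<partial>neg k l z)"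
    using integral_norm_bound_ennreal[OF int(1)] integral_norm_bound_ennreal[OF int(2)]
    by (simp add: add_mono)
  also have "\<dots> \<le> ennreal C * cpn k l z" using g by (rule parts_le_norm)
  finally show ?thesis .
qed

abbreviation "fst_dec i \<equiv> fst (prod_decode i)"
abbreviation "snd_dec i \<equiv> snd (prod_decode i)"

lemma W_nonneg: "z \<in> space (M \<Otimes>\<^sub>M M) \<Longrightarrow> 0 \<le> W z"
  using V_ge_1[of z] V_le_W[of z] by linarith

lemma suminf_cpn_le:
  assumes z: "z \<in> space (M \<Otimes>\<^sub>M M)"
  shows "(\<Sum>i. cpn (fst_dec i) (snd_dec i) z) \<le> ennreal (c * W z)"
proof -
  have "(\<Sum>i. cpn (fst_dec i) (snd_dec i) z) = (\<Sum>k. \<Sum>l. cpn k l z)"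
    using suminf_ennreal_2dimen[of "\<lambda>k. \<Sum>l. cpn k l z" "\<lambda>(k, l). cpn k l z"]
    by (simp add: case_prod_beta)
  also have "\<dots> \<le> ennreal (c * W z)"
    using z condition_C by (auto simp: space_pair_measure)
  finally show ?thesis .
qed

lemma
  assumes g: "dominated g C" and z: "z \<in> space (M \<Otimes>\<^sub>M M)"
  shows summable_F: "summable (\<lambda>i. \<bar>F (fst_dec i) (snd_dec i) g z\<bar>)"
    and suminf_F_le: "(\<Sum>i. \<bar>F (fst_dec i) (snd_dec i) g z\<bar>) \<le> C * (c * W z)"
proof -
  have "(\<Sum>i. ennreal \<bar>F (fst_dec i) (snd_dec i) g z\<bar>) \<le> (\<Sum>i. ennreal C * cpn (fst_dec i) (snd_dec i) z)"
    using F_bound[OF g z] by (intro suminf_le) auto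
  also have "\<dots> \<le> ennreal C * ennreal (c * W z)"
    using suminf_cpn_le[OF z] by (simp add: mult_left_mono)
  finally have le: "(\<Sum>i. ennreal \<bar>F (fst_dec i) (snd_dec i) g z\<bar>) \<le> ennreal (C * (c * W z))"
    using dominatedD(2)[OF g] by (simp add: ennreal_mult')
  have nonneg: "0 \<le> C * (c * W z)"
    using dominatedD(2)[OF g] c_nonneg W_nonneg[OF z] by simp
  show "summable (\<lambda>i. \<bar>F (fst_dec i) (snd_dec i) g z\<bar>)"
    by (rule suminf_ennreal_le_real(1)[OF _ le nonneg]) simp
  show "(\<Sum>i. \<bar>F (fst_dec i) (snd_dec i) g z\<bar>) \<le> C * (c * W z)"
    by (rule suminf_ennreal_le_real(2)[OF _ le nonneg]) simp
qed

text \<open>\<open>Gbar2\<close> as a pointwise series instead of an integral against the resolvent.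
  A single index provides the partial sums for dominated convergence.\<close>

definition G :: "('a \<times> 'a \<Rightarrow> real) \<Rightarrow> 'a \<times> 'a \<Rightarrow> real" where
  "G g z = (\<Sum>i. F (fst_dec i) (snd_dec i) g z)"

lemma G_measurable[measurable]:
  assumes [measurable]: "g \<in> borel_measurable (M \<Otimes>\<^sub>M M)"
  shows "G g \<in> borel_measurable (M \<Otimes>\<^sub>M M)"
  unfolding G_def by measurable

lemma G_bound:
  assumes g: "dominated g C" and z: "z \<in> space (M \<Otimes>\<^sub>M M)"
  shows "\<bar>G g z\<bar> \<le> C * (c * W z)"
  using summable_rabs[OF summable_F[OF g z]] suminf_F_le[OF g z] by (simp add: G_def)

text \<open>Dominated convergence: all partial sums are at most \<open>C * (c * W w)\<close> in
  absolute value, and this majorant is integrable by the hypothesis on \<open>W\<close>.\<close>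

lemma
  fixes a b :: nat
  assumes g: "dominated g C" and z: "z \<in> space (M \<Otimes>\<^sub>M M)"
    and W: "(\<integral>\<^sup>+w. ennreal (W w) \<partial>ker2 a b z) < \<infinity>"
  shows integrable_G: "integrable (ker2 a b z) (G g)"
    and sums_T_G: "(\<lambda>i. F (fst_dec i + a) (snd_dec i + b) g z) sums T a b (G g) z"
proof -
  note sets = ker2_space(3)[OF z, of a b] and space = ker2_space(4)[OF z, of a b]
  have meas: "f \<in> borel_measurable (ker2 a b z)" if "f \<in> borel_measurable (M \<Otimes>\<^sub>M M)" for f :: "_ \<Rightarrow> real"
    using that sets by (simp cong: measurable_cong_sets)
  have g'[measurable]: "g \<in> borel_measurable (M \<Otimes>\<^sub>M M)" by (rule dominatedD(1)[OF g])
  have W': "integrable (ker2 a b z) W"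
    using W W_nonneg space by (intro integrableI_nonneg meas) auto
  then have dom: "integrable (ker2 a b z) (\<lambda>w. C * (c * W w))" by simp
  have lim: "(\<lambda>n. \<Sum>i<n. F (fst_dec i) (snd_dec i) g w) \<longlonglongrightarrow> G g w"
    if "w \<in> space (M \<Otimes>\<^sub>M M)" for w
    using summable_LIMSEQ[OF summable_rabs_cancel[OF summable_F[OF g that]]] by (simp add: G_def)
  \<comment> \<open>The bound is uniform in \<open>n\<close> because it comes from the full series
    of absolute values.\<close>
  have bound: "norm (\<Sum>i<n. F (fst_dec i) (snd_dec i) g w) \<le> C * (c * W w)"
    if "w \<in> space (M \<Otimes>\<^sub>M M)" for n w
  proof -
    have "norm (\<Sum>i<n. F (fst_dec i) (snd_dec i) g w) \<le> (\<Sum>i<n. \<bar>F (fst_dec i) (snd_dec i) g w\<bar>)"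
      by (simp add: sum_abs)
    also have "\<dots> \<le> (\<Sum>i. \<bar>F (fst_dec i) (snd_dec i) g w\<bar>)"
      by (intro sum_le_suminf summable_F[OF g that]) auto
    also have "\<dots> \<le> C * (c * W w)" by (rule suminf_F_le[OF g that])
    finally show ?thesis .
  qed
  have mG: "G g \<in> borel_measurable (ker2 a b z)" by (intro meas) measurable
  have mS: "(\<lambda>w. \<Sum>i<n. F (fst_dec i) (snd_dec i) g w) \<in> borel_measurable (ker2 a b z)" for n
    by (intro meas) measurable
  have aeL: "AE w in ker2 a b z. (\<lambda>n. \<Sum>i<n. F (fst_dec i) (snd_dec i) g w) \<longlonglongrightarrow> G g w"
    using lim space by (auto intro!: AE_I2)
  have aeB: "AE w in ker2 a b z. norm (\<Sum>i<n. F (fst_dec i) (snd_dec i) g w) \<le> C * (c * W w)" for n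
    using bound space by (auto intro!: AE_I2)
  show "integrable (ker2 a b z) (G g)"
    by (rule integrable_dominated_convergence[OF mG mS dom aeL aeB])
  have int: "integrable (ker2 a b z) (F k l g)" for k l
    unfolding F_def using integrable_T[OF g z] by simp
  have "(\<lambda>n. \<integral>w. (\<Sum>i<n. F (fst_dec i) (snd_dec i) g w) \<partial>ker2 a b z) \<longlonglongrightarrow> T a b (G g) z"
    unfolding T_def by (rule integral_dominated_convergence[OF mG mS dom aeL aeB])
  moreover have "(\<integral>w. (\<Sum>i<n. F (fst_dec i) (snd_dec i) g w) \<partial>ker2 a b z) =
      (\<Sum>i<n. F (fst_dec i + a) (snd_dec i + b) g z)" for n
    using int by (simp add: T_F[OF g z, symmetric] T_def)
  ultimately show "(\<lambda>i. F (fst_dec i + a) (snd_dec i + b) g z) sums T a b (G g) z"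
    by (simp add: sums_def)
qed

text \<open>Both sides are the same shifted series: acting on the sum shifts by \<open>T_F\<close>,
  acting on \<open>g\<close> shifts by \<open>F_T\<close>.\<close>

lemma T_G:
  fixes a b :: nat
  assumes g: "dominated g C" and z: "z \<in> space (M \<Otimes>\<^sub>M M)"
    and W: "(\<integral>\<^sup>+w. ennreal (W w) \<partial>ker2 a b z) < \<infinity>"
  shows "T a b (G g) z = G (T a b g) z"
  using sums_unique[OF sums_T_G[OF assms]] by (simp add: G_def F_T[OF g z])

text \<open>The witnesses are the summed positive and the summed negative parts. They need not be
  the Jordan parts of the resolvent, but any decomposition into finite measures that integrate
  \<open>g\<close> determines the signed integral.\<close>

lemma resolvent2:
  assumes z: "z \<in> space (M \<Otimes>\<^sub>M M)"
  obtains \<alpha> \<beta> where "finite_measure \<alpha>" "finite_measure \<beta>"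
    "sets \<alpha> = sets (M \<Otimes>\<^sub>M M)" "sets \<beta> = sets (M \<Otimes>\<^sub>M M)"
    "\<And>E. E \<in> sets (M \<Otimes>\<^sub>M M) \<Longrightarrow> (\<lambda>(k, l). cp k l z E) summable_on UNIV"
    "\<And>E. E \<in> sets (M \<Otimes>\<^sub>M M) \<Longrightarrow> resolvent2 M P \<mu> (fst z) (snd z) E = measure \<alpha> E - measure \<beta> E"
    "\<And>g C. dominated g C \<Longrightarrow> integrable \<alpha> g" "\<And>g C. dominated g C \<Longrightarrow> integrable \<beta> g"
    "\<And>g C. dominated g C \<Longrightarrow> G g z = (\<integral>w. g w \<partial>\<alpha>) - (\<integral>w. g w \<partial>\<beta>)"
proof -
  define p where "p i = pos (fst_dec i) (snd_dec i) z" for i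
  define n where "n i = neg (fst_dec i) (snd_dec i) z" for i
  define \<alpha> where "\<alpha> = sum_measure (M \<Otimes>\<^sub>M M) p"
  define \<beta> where "\<beta> = sum_measure (M \<Otimes>\<^sub>M M) n"
  have sets: "sets (p i) = sets (M \<Otimes>\<^sub>M M)" "sets (n i) = sets (M \<Otimes>\<^sub>M M)" for i
    by (simp_all add: p_def n_def)
  have sets': "sets \<alpha> = sets (M \<Otimes>\<^sub>M M)" "sets \<beta> = sets (M \<Otimes>\<^sub>M M)"
    by (simp_all add: \<alpha>_def \<beta>_def)
  have fin_sum: "(\<Sum>i. ennreal C * cpn (fst_dec i) (snd_dec i) z) < \<infinity>" for C
    using suminf_cpn_le[OF z] by (auto simp: ennreal_mult_less_top intro: le_less_trans)
  have bound: "(\<integral>\<^sup>+w. ennreal \<bar>g w\<bar> \<partial>\<alpha>) < \<infinity>" "(\<integral>\<^sup>+w. ennreal \<bar>g w\<bar> \<partial>\<beta>) < \<infinity>"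
    if g: "dominated g C" for g C
  proof -
    have "(\<integral>\<^sup>+w. ennreal \<bar>g w\<bar> \<partial>p i) \<le> ennreal C * cpn (fst_dec i) (snd_dec i) z"
      and "(\<integral>\<^sup>+w. ennreal \<bar>g w\<bar> \<partial>n i) \<le> ennreal C * cpn (fst_dec i) (snd_dec i) z" for i
      using parts_le_norm[OF g, of "fst_dec i" "snd_dec i" z] unfolding p_def n_def
      by (auto intro: order_trans[rotated])
    note le = this
    have fin: "suminf u < \<infinity>" if "\<And>i. u i \<le> ennreal C * cpn (fst_dec i) (snd_dec i) z" for u
      using that by (rule le_less_trans[OF suminf_le fin_sum]) auto
    from fin[OF le(1)] fin[OF le(2)]
    show "(\<integral>\<^sup>+w. ennreal \<bar>g w\<bar> \<partial>\<alpha>) < \<infinity>" "(\<integral>\<^sup>+w. ennreal \<bar>g w\<bar> \<partial>\<beta>) < \<infinity>"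
      using dominatedD(1)[OF g] by (simp_all add: \<alpha>_def \<beta>_def nn_integral_sum_measure sets)
  qed
  have int: "integrable \<alpha> g" "integrable \<beta> g" if g: "dominated g C" for g C
    using bound[OF g] dominatedD(1)[OF g] sets'
    by (simp_all add: integrable_iff_bounded cong: measurable_cong_sets)
  \<comment> \<open>Since \<open>V\<close> is at least 1, indicators are dominated with constant 1;
    the statements about masses are thus instances of those about integrals.\<close>
  have ind: "dominated (indicator E) 1" if "E \<in> sets (M \<Otimes>\<^sub>M M)" for E
    using that V_ge_1 by (auto simp: dominated_def indicator_def intro: order_trans[of 0 1])
  have int_sums: "(\<lambda>i. \<integral>w. g w \<partial>p i) sums (\<integral>w. g w \<partial>\<alpha>)" "(\<lambda>i. \<integral>w. g w \<partial>n i) sums (\<integral>w. g w \<partial>\<beta>)"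
    if g: "dominated g C" for g C
    using int[OF g] unfolding \<alpha>_def \<beta>_def by (auto intro!: integral_sum_measure sets)
  have measure_sums: "(\<lambda>i. measure (p i) E) sums measure \<alpha> E" "(\<lambda>i. measure (n i) E) sums measure \<beta> E"
    if E: "E \<in> sets (M \<Otimes>\<^sub>M M)" for E
    using int_sums[OF ind[OF E]] E sets sets' by simp_all
  have fin: "finite_measure \<alpha>" "finite_measure \<beta>"
    using bound[OF ind[OF sets.top]] sets_eq_imp_space_eq[OF sets'(1)] sets_eq_imp_space_eq[OF sets'(2)]
    by (auto intro!: finite_measureI simp: sets' ennreal_indicator)
  have cp: "cp (fst_dec i) (snd_dec i) z E = measure (p i) E - measure (n i) E"
    if "E \<in> sets (M \<Otimes>\<^sub>M M)" for i E
    using centered_pair_parts(3)[OF z that] by (simp add: p_def n_def)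
  have abs: "summable (\<lambda>i. \<bar>case prod_decode i of (k, l) \<Rightarrow> cp k l z E\<bar>)"
    if E: "E \<in> sets (M \<Otimes>\<^sub>M M)" for E
  proof (rule summable_comparison_test')
    show "summable (\<lambda>i. measure (p i) E + measure (n i) E)"
      using measure_sums[OF E] by (intro summable_add) (auto simp: sums_iff)
    show "norm \<bar>case prod_decode i of (k, l) \<Rightarrow> cp k l z E\<bar> \<le> measure (p i) E + measure (n i) E" for i
      using cp[OF E, of i] by (simp add: case_prod_beta abs_le_iff add_increasing add_increasing2)
  qed
  note summ = summable_on_prod_decode[OF abs] infsum_eq_suminf_prod_decode[OF summable_on_prod_decode[OF abs]]
  have R: "resolvent2 M P \<mu> (fst z) (snd z) E = measure \<alpha> E - measure \<beta> E" if E: "E \<in> sets (M \<Otimes>\<^sub>M M)" for E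
  proof -
    have "resolvent2 M P \<mu> (fst z) (snd z) E = (\<Sum>i. cp (fst_dec i) (snd_dec i) z E)"
      using summable_on_pairD(3)[OF summ(1)[OF E]] summ(2)[OF E]
      by (simp add: resolvent2_def case_prod_beta)
    also have "\<dots> = measure \<alpha> E - measure \<beta> E"
      unfolding cp[OF E] using sums_diff[OF measure_sums[OF E]] by (simp add: sums_iff)
    finally show ?thesis .
  qed
  have G: "G g z = (\<integral>w. g w \<partial>\<alpha>) - (\<integral>w. g w \<partial>\<beta>)" if g: "dominated g C" for g C
    using sums_diff[OF int_sums[OF g]] unfolding G_def centered_pair_parts(6)[OF z g]
    by (simp add: sums_iff p_def n_def)
  show thesis
    by (rule that[OF fin sets' summ(1) R int G])
qed

lemma poisson_equation:
  assumes g: "dominated g C" and z: "z \<in> space (M \<Otimes>\<^sub>M M)"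
    and W: "\<And>a b. a \<le> 1 \<Longrightarrow> b \<le> 1 \<Longrightarrow> (\<integral>\<^sup>+w. ennreal (W w) \<partial>ker2 (enat a) (enat b) z) < \<infinity>"
  shows "G g z - T 0 1 (G g) z - (T 1 0 (G g) z - T 1 1 (G g) z) = F 0 0 g z"
proof -
  have *: "(\<lambda>(i, j). F (i + a) (j + b) g z) summable_on UNIV \<and>
      T (enat a) (enat b) (G g) z = (\<Sum>\<^sub>\<infinity>(i, j). F (i + a) (j + b) g z)"
    if ab: "a \<le> 1" "b \<le> 1" for a b
  proof
    define f where "f = (\<lambda>(i, j). F i j g z)"
    define h where "h = (\<lambda>(i, j). (i + a, j + b))"
    have "f summable_on UNIV"
      using summable_F[OF g z] by (intro summable_on_prod_decode) (simp add: f_def case_prod_beta)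
    \<comment> \<open>A shifted series is the original one on a quadrant, reindexed
      injectively.\<close>
    then have "f summable_on range h" by (rule summable_on_subset_banach) simp
    moreover have "inj h" by (auto simp: inj_def h_def)
    ultimately have "(f \<circ> h) summable_on UNIV" by (simp add: summable_on_reindex)
    moreover have "f \<circ> h = (\<lambda>(i, j). F (i + a) (j + b) g z)"
      by (auto simp: f_def h_def)
    ultimately show s: "(\<lambda>(i, j). F (i + a) (j + b) g z) summable_on UNIV" by simp
    show "T (enat a) (enat b) (G g) z = (\<Sum>\<^sub>\<infinity>(i, j). F (i + a) (j + b) g z)"
      using sums_unique[OF sums_T_G[OF g z W[OF ab]]] infsum_eq_suminf_prod_decode[OF s]
      by (simp add: case_prod_beta)
  qed
  have "T 0 0 (G g) z = G g z"
    using sums_unique[OF sums_T_G[OF g z W[of 0 0]]] by (simp add: G_def zero_enat_def)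
  then show ?thesis
    using *[of 0 0] *[of 0 1] *[of 1 0] *[of 1 1]
      infsum_telescope_pair[of "\<lambda>(i, j). F i j g z"]
    by (simp add: zero_enat_def one_enat_def case_prod_beta)
qed

end

section \<open>Passing between pointwise bounds, the operators \<open>T\<close>, and the norms and
  integrals of the statement\<close>

lemma signed_integral_cong:
  assumes "\<And>x. x \<in> space M \<Longrightarrow> f x = g x"
  shows "signed_integral M R f = signed_integral M R g"
  using assms unfolding signed_integral_def
  by (intro arg_cong2[where f = "(-)"] Bochner_Integration.integral_cong) auto

text \<open>The constant obtained is the norm itself, so a bound linear in \<open>C\<close> turns
  into an inequality between norms.\<close>

lemma weighted_space_bound:
  assumes f: "f \<in> weighted_space N U" and U: "\<And>x. x \<in> space N \<Longrightarrow> 1 \<le> U x"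
  obtains C where "0 \<le> C" "weighted_norm N U f = ennreal C"
    "\<And>x. x \<in> space N \<Longrightarrow> \<bar>f x\<bar> \<le> C * U x"
proof
  let ?C = "enn2real (weighted_norm N U f)"
  show C: "weighted_norm N U f = ennreal ?C"
    using f by (simp add: weighted_space_def)
  fix x assume x: "x \<in> space N"
  then have "ennreal (\<bar>f x\<bar> / U x) \<le> ennreal ?C"
    unfolding C[symmetric] unfolding weighted_norm_def by (rule SUP_upper)
  then show "\<bar>f x\<bar> \<le> ?C * U x"
    using U[OF x] by (simp add: field_simps)
qed simp

lemma weighted_norm_le:
  assumes "\<And>x. x \<in> space N \<Longrightarrow> 1 \<le> U x" "0 \<le> C" "\<And>x. x \<in> space N \<Longrightarrow> \<bar>f x\<bar> \<le> C * U x"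
  shows "weighted_norm N U f \<le> ennreal C"
  unfolding weighted_norm_def
proof (rule SUP_least, rule ennreal_leI)
  fix x assume x: "x \<in> space N"
  show "\<bar>f x\<bar> / U x \<le> C"
    using assms(1)[OF x] assms(3)[OF x] by (simp add: divide_le_eq)
qed

context poisson2
begin

lemma return_eq_ker: "return M = ker 0" "x \<in> space M \<Longrightarrow> P x = ker 1 x"
proof -
  show "return M = ker 0" by (simp add: fun_eq_iff zero_enat_def)
  assume "x \<in> space M"
  then show "P x = ker 1 x"
    using P by (simp add: one_enat_def bind_return[where N = M] measurable_prob_algebraD)
qed

lemma
  assumes xy: "x \<in> space M" "y \<in> space M" and g: "integrable (ker2 m n (x, y)) g"
  shows T_iterated: "T m n g (x, y) = (\<integral>u. (\<integral>v. g (u, v) \<partial>ker n y) \<partial>ker m x)"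
    and integrable_T_fst: "integrable (ker m x) (\<lambda>u. \<integral>v. g (u, v) \<partial>ker n y)"
proof -
  interpret pair_sigma_finite "ker m x" "ker n y"
    using xy by (intro pair_sigma_finiteI ker_space)
  show "T m n g (x, y) = (\<integral>u. (\<integral>v. g (u, v) \<partial>ker n y) \<partial>ker m x)"
    "integrable (ker m x) (\<lambda>u. \<integral>v. g (u, v) \<partial>ker n y)"
    using g integral_fst'[of g] integrable_fst'[of g] by (simp_all add: T_def ker2_def)
qed

lemma
  assumes xy: "x \<in> space M" "y \<in> space M" and g: "integrable (ker2 m 0 (x, y)) g"
    and m: "g \<in> borel_measurable (M \<Otimes>\<^sub>M M)"
  shows T_fst: "T m 0 g (x, y) = (\<integral>u. g (u, y) \<partial>ker m x)"
    and integrable_fst: "integrable (ker m x) (\<lambda>u. g (u, y))"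
proof -
  have *: "(\<integral>v. g (u, v) \<partial>ker 0 y) = g (u, y)" if "u \<in> space (ker m x)" for u
    using xy m that by (subst return_eq_ker(1)[symmetric], intro integral_return) (auto simp: ker_space)
  show "T m 0 g (x, y) = (\<integral>u. g (u, y) \<partial>ker m x)"
    unfolding T_iterated[OF xy g] by (intro Bochner_Integration.integral_cong *) auto
  show "integrable (ker m x) (\<lambda>u. g (u, y))"
    using integrable_T_fst[OF xy g] by (simp add: * cong: Bochner_Integration.integrable_cong)
qed

lemma
  assumes xy: "x \<in> space M" "y \<in> space M" and g: "integrable (ker2 0 n (x, y)) g"
    and m: "g \<in> borel_measurable (M \<Otimes>\<^sub>M M)"
  shows T_snd: "T 0 n g (x, y) = (\<integral>v. g (x, v) \<partial>ker n y)"
    and integrable_snd: "integrable (ker n y) (\<lambda>v. g (x, v))"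
proof -
  interpret prob_space "ker n y" using xy by (simp add: ker_space)
  have "g \<in> borel_measurable (M \<Otimes>\<^sub>M ker n y)"
    using m xy by (simp add: ker_space cong: measurable_cong_sets sets_pair_measure_cong)
  then have "(\<lambda>u. \<integral>v. g (u, v) \<partial>ker n y) \<in> borel_measurable M"
    by (intro borel_measurable_lebesgue_integral) (simp add: case_prod_beta)
  then show "T 0 n g (x, y) = (\<integral>v. g (x, v) \<partial>ker n y)"
    unfolding T_iterated[OF xy g] using xy by (simp add: return_eq_ker(1)[symmetric] integral_return)
  \<comment> \<open>Fubini would give integrable sections almost everywhere only; the section at the
    point \<open>x\<close> itself is obtained by evaluating the Dirac measure.\<close>
  have "(\<integral>\<^sup>+v. ennreal \<bar>g (x, v)\<bar> \<partial>ker n y) = (\<integral>\<^sup>+w. ennreal \<bar>g w\<bar> \<partial>ker2 0 n (x, y))"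
  proof -
    have "(\<integral>\<^sup>+w. ennreal \<bar>g w\<bar> \<partial>ker2 0 n (x, y)) = (\<integral>\<^sup>+u. \<integral>\<^sup>+v. ennreal \<bar>g (u, v)\<bar> \<partial>ker n y \<partial>return M x)"
      using xy m by (simp add: nn_integral_ker2 return_eq_ker)
    also have "\<dots> = (\<integral>\<^sup>+v. ennreal \<bar>g (x, v)\<bar> \<partial>ker n y)"
      using xy \<open>g \<in> borel_measurable (M \<Otimes>\<^sub>M ker n y)\<close>
      by (intro nn_integral_return borel_measurable_nn_integral) (auto simp: case_prod_beta)
    finally show ?thesis by simp
  qed
  moreover have "(\<lambda>v. g (x, v)) \<in> borel_measurable M" using m xy by simp
  then have "(\<lambda>v. g (x, v)) \<in> borel_measurable (ker n y)"
    using ker_space(4)[OF xy(2), of n] by (simp cong: measurable_cong_sets)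
  ultimately show "integrable (ker n y) (\<lambda>v. g (x, v))"
    using g by (simp add: integrable_iff_bounded)
qed

end

section \<open>The second Hoeffding projection and its degeneracy\<close>

locale hoeffding2 = poisson2 +
  fixes h :: "'a \<times> 'a \<Rightarrow> real" and C :: real
  assumes h_measurable [measurable]: "h \<in> borel_measurable (M \<Otimes>\<^sub>M M)"
    and h_symmetric: "\<And>x y. x \<in> space M \<Longrightarrow> y \<in> space M \<Longrightarrow> h (x, y) = h (y, x)"
    and h_integrable: "(\<integral>\<^sup>+x. \<integral>\<^sup>+y. ennreal \<bar>h (x, y)\<bar> \<partial>\<mu> \<partial>\<mu>) < \<infinity>"
    and hbar2_dominated: "dominated (hbar2 \<mu> h) C"
begin

lemma integrable_hbar1: "integrable \<mu> (hbar1 \<mu> h)"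
  and integral_hbar1: "(\<integral>x. hbar1 \<mu> h x \<partial>\<mu>) = 0"
proof -
  interpret \<mu>: prob_space \<mu> by (rule \<mu>)
  interpret pair_prob_space \<mu> \<mu> ..
  have h: "h \<in> borel_measurable (\<mu> \<Otimes>\<^sub>M \<mu>)"
    using h_measurable \<mu>(4) by (simp cong: measurable_cong_sets sets_pair_measure_cong)
  then have "integrable (\<mu> \<Otimes>\<^sub>M \<mu>) h"
    using h_integrable by (simp add: integrable_iff_bounded \<mu>.nn_integral_fst[symmetric])
  then have *: "integrable \<mu> (\<lambda>x. \<integral>y. h (x, y) \<partial>\<mu>)"
    by (rule integrable_fst')
  then show "integrable \<mu> (hbar1 \<mu> h)" unfolding hbar1_def by simp
  show "(\<integral>x. hbar1 \<mu> h x \<partial>\<mu>) = 0"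
    unfolding hbar1_def using * by (simp add: theta_def \<mu>.prob_space)
qed

text \<open>
  The domination by \<open>V\<close> makes every section \<open>h (x, \<cdot>)\<close> integrable, so the degeneracy holds at every
  point and not only almost everywhere.
\<close>

lemma hbar2_degenerate:
  assumes x: "x \<in> space M"
  shows "(\<integral>y. hbar2 \<mu> h (x, y) \<partial>\<mu>) = 0"
proof -
  interpret \<mu>: prob_space \<mu> by (rule \<mu>)
  \<comment> \<open>Only the first coordinate of this base point matters: at times 0 and \<infinity>
    the product kernel is the Dirac measure at \<open>x\<close> times \<mu>.\<close>
  have z: "(x, x) \<in> space (M \<Otimes>\<^sub>M M)" using x by (simp add: space_pair_measure)
  have int: "integrable \<mu> (\<lambda>y. hbar2 \<mu> h (x, y))"
    using integrable_snd[OF x x dominated_integrable[OF hbar2_dominated z] dominatedD(1)[OF hbar2_dominated], of \<infinity>]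
    by simp
  \<comment> \<open>The section of \<open>h\<close> is rebuilt from summands already known to be
    integrable, so its integral may be split; solving for the \<open>hbar2\<close> term gives 0 by
    the definition of \<open>hbar1\<close>.\<close>
  have "(\<integral>y. h (x, y) \<partial>\<mu>) = (\<integral>y. hbar2 \<mu> h (x, y) + hbar1 \<mu> h x + hbar1 \<mu> h y + theta \<mu> h \<partial>\<mu>)"
    by (simp add: hbar2_def)
  also have "\<dots> = (\<integral>y. hbar2 \<mu> h (x, y) \<partial>\<mu>) + hbar1 \<mu> h x + theta \<mu> h"
    using int integrable_hbar1 by (simp add: integral_hbar1 \<mu>.prob_space)
  finally show ?thesis by (simp add: hbar1_def)
qed

lemma hbar2_symmetric:
  assumes "x \<in> space M" "y \<in> space M"
  shows "hbar2 \<mu> h (x, y) = hbar2 \<mu> h (y, x)"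
  using h_symmetric[OF assms] by (simp add: hbar2_def)

text \<open>Each term of \<open>F\<close> with a time \<infinity> integrates some coordinate against
  \<mu> and vanishes by degeneracy; symmetry handles the first coordinate.\<close>

lemma F_hbar2_0_0:
  assumes z: "z \<in> space (M \<Otimes>\<^sub>M M)"
  shows "F 0 0 (hbar2 \<mu> h) z = hbar2 \<mu> h z"
proof -
  interpret \<mu>: prob_space \<mu> by (rule \<mu>)
  obtain x y where xy: "z = (x, y)" "x \<in> space M" "y \<in> space M"
    using z by (auto simp: space_pair_measure)
  note int = dominated_integrable[OF hbar2_dominated z, unfolded xy(1)]
  note m = dominatedD(1)[OF hbar2_dominated]
  have sp: "space \<mu> = space M" using \<mu>(4) by (rule sets_eq_imp_space_eq)
  have "T 0 0 (hbar2 \<mu> h) z = (\<integral>u. hbar2 \<mu> h (u, y) \<partial>return M x)"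
    using T_fst[OF xy(2,3) int m] xy by (simp add: return_eq_ker)
  also have "\<dots> = hbar2 \<mu> h z"
    using xy m by (subst integral_return) auto
  finally have 1: "T 0 0 (hbar2 \<mu> h) z = hbar2 \<mu> h z" .
  have 2: "T 0 \<infinity> (hbar2 \<mu> h) z = 0"
    using T_snd[OF xy(2,3) int m, of \<infinity>] xy by (simp add: hbar2_degenerate)
  have "T \<infinity> 0 (hbar2 \<mu> h) z = (\<integral>u. hbar2 \<mu> h (u, y) \<partial>\<mu>)"
    using T_fst[OF xy(2,3) int m, of \<infinity>] xy by simp
  also have "\<dots> = (\<integral>u. hbar2 \<mu> h (y, u) \<partial>\<mu>)"
    using xy sp by (intro Bochner_Integration.integral_cong hbar2_symmetric) auto
  finally have 3: "T \<infinity> 0 (hbar2 \<mu> h) z = 0" using xy by (simp add: hbar2_degenerate)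
  have "T \<infinity> \<infinity> (hbar2 \<mu> h) z = (\<integral>u. \<integral>v. hbar2 \<mu> h (u, v) \<partial>\<mu> \<partial>\<mu>)"
    using T_iterated[OF xy(2,3) int, of \<infinity> \<infinity>] xy by simp
  also have "\<dots> = (\<integral>u. 0 \<partial>\<mu>)"
    using sp by (intro Bochner_Integration.integral_cong) (auto simp: hbar2_degenerate)
  finally have 4: "T \<infinity> \<infinity> (hbar2 \<mu> h) z = 0" by simp
  show ?thesis
    using 1 2 3 4 by (simp add: F_def zero_enat_def[symmetric])
qed

text \<open>\<open>Gbar2\<close> integrates against the Jordan parts of the resolvent,
  \<open>G\<close> adds up those of its summands. Both are evaluated through the same
  decomposition.\<close>

lemma Gbar2_eq_G:
  assumes z: "z \<in> space (M \<Otimes>\<^sub>M M)"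
  shows "Gbar2 M P \<mu> h z = G (hbar2 \<mu> h) z"
proof -
  obtain \<alpha> \<beta> where fin: "finite_measure \<alpha>" "finite_measure \<beta>"
    and sets: "sets \<alpha> = sets (M \<Otimes>\<^sub>M M)" "sets \<beta> = sets (M \<Otimes>\<^sub>M M)"
    and R: "\<And>E. E \<in> sets (M \<Otimes>\<^sub>M M) \<Longrightarrow> resolvent2 M P \<mu> (fst z) (snd z) E = measure \<alpha> E - measure \<beta> E"
    and int: "\<And>g C. dominated g C \<Longrightarrow> integrable \<alpha> g" "\<And>g C. dominated g C \<Longrightarrow> integrable \<beta> g"
    and G: "\<And>g C. dominated g C \<Longrightarrow> G g z = (\<integral>w. g w \<partial>\<alpha>) - (\<integral>w. g w \<partial>\<beta>)"
    by (rule resolvent2[OF z]) blast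
  show ?thesis
    using signed_integral_eq_diff[OF fin sets R int[OF hbar2_dominated]]
    by (simp add: G[OF hbar2_dominated] Gbar2_def case_prod_beta)
qed

lemma Gbar2_well_defined: "Gbar2_well_defined M P \<mu> h"
  unfolding Gbar2_well_defined_def
proof (intro ballI)
  fix x y assume "x \<in> space M" "y \<in> space M"
  then have z: "(x, y) \<in> space (M \<Otimes>\<^sub>M M)" by (simp add: space_pair_measure)
  obtain \<alpha> \<beta> where fin: "finite_measure \<alpha>" "finite_measure \<beta>"
    and sets: "sets \<alpha> = sets (M \<Otimes>\<^sub>M M)" "sets \<beta> = sets (M \<Otimes>\<^sub>M M)"
    and summ: "\<And>E. E \<in> sets (M \<Otimes>\<^sub>M M) \<Longrightarrow> (\<lambda>(k, l). centered_pair M P \<mu> k l x y E) summable_on UNIV"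
    and R: "\<And>E. E \<in> sets (M \<Otimes>\<^sub>M M) \<Longrightarrow> resolvent2 M P \<mu> x y E = measure \<alpha> E - measure \<beta> E"
    and int: "\<And>g C. dominated g C \<Longrightarrow> integrable \<alpha> g" "\<And>g C. dominated g C \<Longrightarrow> integrable \<beta> g"
    by (rule resolvent2[OF z, unfolded fst_conv snd_conv]) blast
  show "(\<forall>E\<in>sets (M \<Otimes>\<^sub>M M). (\<lambda>(n\<^sub>1, n\<^sub>2). centered_pair M P \<mu> n\<^sub>1 n\<^sub>2 x y E) summable_on UNIV) \<and>
      finite_signed_measure (M \<Otimes>\<^sub>M M) (resolvent2 M P \<mu> x y) \<and>
      signed_integrable (M \<Otimes>\<^sub>M M) (resolvent2 M P \<mu> x y) (hbar2 \<mu> h)"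
    using summ finite_signed_measure_diff[OF fin sets R]
      signed_integrable_diff[OF fin sets R int[OF hbar2_dominated]] by blast
qed

lemma Gbar2_measurable: "Gbar2 M P \<mu> h \<in> borel_measurable (M \<Otimes>\<^sub>M M)"
  using G_measurable[OF dominatedD(1)[OF hbar2_dominated]]
  by (subst measurable_cong[OF Gbar2_eq_G]) auto

lemma Gbar2_bound:
  assumes z: "z \<in> space (M \<Otimes>\<^sub>M M)"
  shows "\<bar>Gbar2 M P \<mu> h z\<bar> \<le> (c * C) * W z"
  using G_bound[OF hbar2_dominated z] by (simp add: Gbar2_eq_G[OF z] ac_simps)

end

text \<open>Time pair (0, 0) is a value of the real function \<open>W\<close>, while (1, 0) and (1,
  1) are the two assumptions on the action of \<open>P\<close>. The pair (0, 1) reduces to (1, 0) by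
  exchanging the points, through the symmetry of \<open>W\<close>.\<close>

lemma (in poisson2) W_ker2_finite:
  fixes a b :: nat
  assumes sym: "\<And>x y. x \<in> space M \<Longrightarrow> y \<in> space M \<Longrightarrow> W (x, y) = W (y, x)"
    and act: "\<And>x y. x \<in> space M \<Longrightarrow> y \<in> space M \<Longrightarrow> act1_nn P W (x, y) < \<infinity>"
      "\<And>x y. x \<in> space M \<Longrightarrow> y \<in> space M \<Longrightarrow> act2_nn P W (x, y) < \<infinity>"
    and z: "z \<in> space (M \<Otimes>\<^sub>M M)" and ab: "a \<le> 1" "b \<le> 1"
  shows "(\<integral>\<^sup>+w. ennreal (W w) \<partial>ker2 a b z) < \<infinity>"
proof -
  obtain x y where xy: "z = (x, y)" "x \<in> space M" "y \<in> space M"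
    using z by (auto simp: space_pair_measure)
  have sP: "space (P u) = space M" if "u \<in> space M" for u
    using that by (simp add: return_eq_ker ker_space)
  have it: "(\<integral>\<^sup>+w. ennreal (W w) \<partial>ker2 a b z) = (\<integral>\<^sup>+u. \<integral>\<^sup>+v. ennreal (W (u, v)) \<partial>ker b y \<partial>ker a x)"
    using xy by (simp add: nn_integral_ker2)
  have ret: "(\<integral>\<^sup>+v. ennreal (W (u, v)) \<partial>return M y) = ennreal (W (u, y))" if "u \<in> space M" for u
    using that xy by (intro nn_integral_return) auto
  consider "a = 0" "b = 0" | "a = 1" "b = 0" | "a = 0" "b = 1" | "a = 1" "b = 1"
    using ab by linarith
  then show ?thesis
  proof cases
    case 1
    have "(\<integral>\<^sup>+u. \<integral>\<^sup>+v. ennreal (W (u, v)) \<partial>return M y \<partial>return M x) = (\<integral>\<^sup>+u. ennreal (W (u, y)) \<partial>return M x)"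
      by (intro nn_integral_cong ret) simp
    also have "\<dots> = ennreal (W (x, y))"
      using xy by (intro nn_integral_return) auto
    finally show ?thesis unfolding it using 1 by simp
  next
    case 2
    have "(\<integral>\<^sup>+u. \<integral>\<^sup>+v. ennreal (W (u, v)) \<partial>return M y \<partial>P x) = act1_nn P W (x, y)"
      unfolding act1_nn_def prod.case using xy sP by (intro nn_integral_cong ret) auto
    then show ?thesis
      unfolding it using 2 act(1)[OF xy(2,3)] return_eq_ker(2)[OF xy(2)] by (simp add: one_enat_def)
  next
    case 3
    have "(\<integral>\<^sup>+u. \<integral>\<^sup>+v. ennreal (W (u, v)) \<partial>P y \<partial>return M x) = (\<integral>\<^sup>+v. ennreal (W (x, v)) \<partial>P y)"
    proof (rule nn_integral_return)
      interpret prob_space "P y" using xy by (simp add: return_eq_ker ker_space)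
      have "W \<in> borel_measurable (M \<Otimes>\<^sub>M P y)"
        using xy ker_space(4)[OF xy(3), of 1]
        by (simp add: return_eq_ker cong: measurable_cong_sets sets_pair_measure_cong)
      then show "(\<lambda>u. \<integral>\<^sup>+v. ennreal (W (u, v)) \<partial>P y) \<in> borel_measurable M"
        by (intro borel_measurable_nn_integral_fst) auto
    qed (use xy in simp)
    also have "\<dots> = act1_nn P W (y, x)"
      unfolding act1_nn_def prod.case using xy sP sym by (intro nn_integral_cong) simp
    finally show ?thesis
      unfolding it using 3 act(1)[OF xy(3,2)] return_eq_ker(2)[OF xy(3)] by (simp add: one_enat_def)
  next
    case 4
    have "act2_nn P W (x, y) < \<infinity>" using act(2) xy by simp
    then show ?thesis
      unfolding it using 4 xy return_eq_ker(2)[OF xy(2)] return_eq_ker(2)[OF xy(3)]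
      by (simp add: act2_nn_def one_enat_def)
  qed
qed

section \<open>The action of \<open>P\<close> on \<open>Gbar2\<close>, and the Poisson equation for
  it\<close>

locale hoeffding2_finite = hoeffding2 +
  assumes W_finite: "\<And>z a b. z \<in> space (M \<Otimes>\<^sub>M M) \<Longrightarrow> a \<le> 1 \<Longrightarrow> b \<le> 1 \<Longrightarrow>
    (\<integral>\<^sup>+w. ennreal (W w) \<partial>ker2 (enat a) (enat b) z) < \<infinity>"
begin

lemma integrable_Gbar2:
  assumes "z \<in> space (M \<Otimes>\<^sub>M M)" "a \<le> 1" "b \<le> 1"
  shows "integrable (ker2 (enat a) (enat b) z) (Gbar2 M P \<mu> h)"
  using integrable_G[OF hbar2_dominated assms(1) W_finite[OF assms]] ker2_space(4)[OF assms(1)]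
  by (subst Bochner_Integration.integrable_cong[OF refl, where g = "G (hbar2 \<mu> h)"])
    (auto simp: Gbar2_eq_G)

lemma T_Gbar2:
  assumes "z \<in> space (M \<Otimes>\<^sub>M M)"
  shows "T m n (Gbar2 M P \<mu> h) z = T m n (G (hbar2 \<mu> h)) z"
  unfolding T_def using ker2_space(4)[OF assms]
  by (intro Bochner_Integration.integral_cong) (auto simp: Gbar2_eq_G)

lemma act_eq_T:
  assumes f: "f \<in> borel_measurable (M \<Otimes>\<^sub>M M)" and z: "z \<in> space (M \<Otimes>\<^sub>M M)"
  shows "integrable (ker2 1 0 z) f \<Longrightarrow> act1 P f z = T 1 0 f z"
    and "integrable (ker2 1 1 z) f \<Longrightarrow> act2 P f z = T 1 1 f z"
proof -
  obtain x y where xy: "z = (x, y)" "x \<in> space M" "y \<in> space M"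
    using z by (auto simp: space_pair_measure)
  show "integrable (ker2 1 0 z) f \<Longrightarrow> act1 P f z = T 1 0 f z"
    using T_fst[OF xy(2,3) _ f, of 1] xy by (simp add: act1_def return_eq_ker)
  show "integrable (ker2 1 1 z) f \<Longrightarrow> act2 P f z = T 1 1 f z"
    using T_iterated[OF xy(2,3), of 1 1 f] xy by (simp add: act2_def return_eq_ker)
qed

text \<open>By \<open>T_G\<close> the left side is \<open>G\<close> of the transformed function, and
  \<open>G_bound\<close> is applied to that function. Hence its own constant \<open>D\<close>
  appears in place of \<open>C\<close>.\<close>

lemma T_Gbar2_bound:
  assumes ab: "a \<le> 1" "b \<le> 1"
    and D: "dominated f D" "\<And>z. z \<in> space (M \<Otimes>\<^sub>M M) \<Longrightarrow> f z = T (enat a) (enat b) (hbar2 \<mu> h) z"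
    and z: "z \<in> space (M \<Otimes>\<^sub>M M)"
  shows "\<bar>T (enat a) (enat b) (Gbar2 M P \<mu> h) z\<bar> \<le> (c * D) * W z"
proof -
  have "dominated (T (enat a) (enat b) (hbar2 \<mu> h)) D"
    using D T_measurable[OF dominatedD(1)[OF hbar2_dominated]] by (simp add: dominated_def)
  from G_bound[OF this z] show ?thesis
    using T_G[OF hbar2_dominated z W_finite[OF z ab]] by (simp add: T_Gbar2[OF z] ac_simps)
qed

text \<open>Each signed integral may be expanded as soon as its integrand is integrable under both
  the Dirac measure and \<open>P\<close>. With this checked for the inner and then the outer
  integral, the four terms of \<open>poisson_equation\<close> emerge.\<close>

lemma Gbar2_poisson_equation:
  assumes xy: "x \<in> space M" "y \<in> space M"
  shows "hbar2 \<mu> h (x, y) =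
    signed_integral M (measure_diff (return M x) (P x))
      (\<lambda>z\<^sub>1. signed_integral M (measure_diff (return M y) (P y)) (\<lambda>z\<^sub>2. Gbar2 M P \<mu> h (z\<^sub>1, z\<^sub>2)))"
proof -
  let ?G = "Gbar2 M P \<mu> h"
  have z: "(u, v) \<in> space (M \<Otimes>\<^sub>M M)" if "u \<in> space M" "v \<in> space M" for u v
    using that by (simp add: space_pair_measure)
  note m = Gbar2_measurable
  have int: "integrable (ker2 0 0 (u, v)) ?G" "integrable (ker2 0 1 (u, v)) ?G"
    "integrable (ker2 1 0 (u, v)) ?G" "integrable (ker2 1 1 (u, v)) ?G"
    if "u \<in> space M" "v \<in> space M" for u v
    using integrable_Gbar2[OF z[OF that], of 0 0] integrable_Gbar2[OF z[OF that], of 0 1]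
      integrable_Gbar2[OF z[OF that], of 1 0] integrable_Gbar2[OF z[OF that], of 1 1]
    by (simp_all add: zero_enat_def one_enat_def)
  have inner: "signed_integral M (measure_diff (return M y) (P y)) (\<lambda>z\<^sub>2. ?G (u, z\<^sub>2)) = ?G (u, y) - T 0 1 ?G (u, y)"
    if u: "u \<in> space M" for u
  proof -
    have "signed_integral M (measure_diff (ker 0 y) (ker 1 y)) (\<lambda>z\<^sub>2. ?G (u, z\<^sub>2)) =
        (\<integral>v. ?G (u, v) \<partial>ker 0 y) - (\<integral>v. ?G (u, v) \<partial>ker 1 y)"
      using xy u by (intro signed_integral_eq_diff integrable_snd[OF u xy(2) _ m] int)
        (auto simp: measure_diff_def ker_space)
    also have "(\<integral>v. ?G (u, v) \<partial>ker 0 y) = ?G (u, y)"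
      using xy u m by (subst return_eq_ker(1)[symmetric], intro integral_return) auto
    also have "(\<integral>v. ?G (u, v) \<partial>ker 1 y) = T 0 1 ?G (u, y)"
      using T_snd[OF u xy(2) int(2)[OF u xy(2)] m] by simp
    finally show ?thesis using xy by (simp add: return_eq_ker)
  qed
  have T01: "T 0 1 ?G (u, y) = (\<integral>v. ?G (u, v) \<partial>ker 1 y)" if u: "u \<in> space M" for u
    using T_snd[OF u xy(2) int(2)[OF u xy(2)] m] .
  let ?K = "\<lambda>u. ?G (u, y) - T 0 1 ?G (u, y)"
  have Km: "?K \<in> borel_measurable M"
    using m T_measurable[OF m, of 0 1] xy by simp
  \<comment> \<open>Fubini under the product kernel at times (1, 1) provides integrability in the
    outer variable.\<close>
  have int_T01: "integrable (ker 1 x) (\<lambda>u. T 0 1 ?G (u, y))"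
    using integrable_T_fst[OF xy int(4)[OF xy]] ker_space(5)[OF xy(1)]
    by (subst Bochner_Integration.integrable_cong[OF refl, where g = "\<lambda>u. \<integral>v. ?G (u, v) \<partial>ker 1 y"])
      (auto simp: T01)
  have int_fst: "integrable (ker 1 x) (\<lambda>u. ?G (u, y))"
    by (rule integrable_fst[OF xy int(3)[OF xy] m])
  have "signed_integral M (measure_diff (return M x) (P x))
      (\<lambda>z\<^sub>1. signed_integral M (measure_diff (return M y) (P y)) (\<lambda>z\<^sub>2. ?G (z\<^sub>1, z\<^sub>2)))
      = signed_integral M (measure_diff (ker 0 x) (ker 1 x)) ?K"
    unfolding return_eq_ker(1) return_eq_ker(2)[OF xy(1)]
    by (rule signed_integral_cong) (rule inner[unfolded return_eq_ker(1)])
  also have "\<dots> = (\<integral>u. ?K u \<partial>ker 0 x) - (\<integral>u. ?K u \<partial>ker 1 x)"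
  proof (rule signed_integral_eq_diff)
    \<comment> \<open>Under a Dirac measure every measurable real function is integrable.\<close>
    have "integrable (return M x) ?K"
      using Km xy by (auto simp: integrable_iff_bounded nn_integral_return)
    then show "integrable (ker 0 x) ?K" by (simp add: return_eq_ker)
    show "integrable (ker 1 x) ?K" using int_fst int_T01 by simp
  qed (use xy in \<open>auto simp: measure_diff_def ker_space\<close>)
  also have "(\<integral>u. ?K u \<partial>ker 0 x) = ?K x"
    using Km xy by (subst return_eq_ker(1)[symmetric], intro integral_return) auto
  also have "(\<integral>u. ?K u \<partial>ker 1 x) = T 1 0 ?G (x, y) - T 1 1 ?G (x, y)"
  proof -
    have "(\<integral>u. T 0 1 ?G (u, y) \<partial>ker 1 x) = T 1 1 ?G (x, y)"
      unfolding T_iterated[OF xy int(4)[OF xy]] using ker_space(5)[OF xy(1)]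
      by (intro Bochner_Integration.integral_cong) (auto simp: T01)
    then show ?thesis
      using int_fst int_T01 T_fst[OF xy int(3)[OF xy] m] by simp
  qed
  also have "?K x - (T 1 0 ?G (x, y) - T 1 1 ?G (x, y)) = F 0 0 (hbar2 \<mu> h) (x, y)"
    using poisson_equation[OF hbar2_dominated z[OF xy] W_finite[OF z[OF xy]]]
    by (simp add: T_Gbar2[OF z[OF xy]] Gbar2_eq_G[OF z[OF xy]])
  finally show ?thesis using F_hbar2_0_0[OF z[OF xy]] by simp
qed

end

theorem lemma2p1:
  fixes M \<mu> :: "'a measure" and P :: "'a \<Rightarrow> 'a measure"
    and V W :: "'a \<times> 'a \<Rightarrow> real"
  assumes "countably_generated M"
    and "P \<in> M \<rightarrow>\<^sub>M prob_algebra M"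
    and "invariant_distribution M P \<mu>"
    and "V \<in> borel_measurable (M \<Otimes>\<^sub>M M)"
    and "W \<in> borel_measurable (M \<Otimes>\<^sub>M M)"
    and "\<And>x y. x \<in> space M \<Longrightarrow> y \<in> space M \<Longrightarrow> V (x, y) = V (y, x)"
    and "\<And>x y. x \<in> space M \<Longrightarrow> y \<in> space M \<Longrightarrow> W (x, y) = W (y, x)"
    and "\<And>x y. x \<in> space M \<Longrightarrow> y \<in> space M \<Longrightarrow> 1 \<le> V (x, y)"
    and "\<And>x y. x \<in> space M \<Longrightarrow> y \<in> space M \<Longrightarrow> V (x, y) \<le> W (x, y)"
    and "condition_C2 M P \<mu> V W"
    and "\<And>x y. x \<in> space M \<Longrightarrow> y \<in> space M \<Longrightarrow> act1_nn P W (x, y) < \<infinity>"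
    and "\<And>x y. x \<in> space M \<Longrightarrow> y \<in> space M \<Longrightarrow> act2_nn P W (x, y) < \<infinity>"
  shows "\<exists>c::real. 0 \<le> c \<and>
    (\<forall>h :: 'a \<times> 'a \<Rightarrow> real.
      h \<in> borel_measurable (M \<Otimes>\<^sub>M M) \<longrightarrow>
      (\<forall>x\<in>space M. \<forall>y\<in>space M. h (x, y) = h (y, x)) \<longrightarrow>
      (\<integral>\<^sup>+x. (\<integral>\<^sup>+y. ennreal \<bar>h (x, y)\<bar> \<partial>\<mu>) \<partial>\<mu>) < \<infinity> \<longrightarrow>
      hbar2 \<mu> h \<in> weighted_space (M \<Otimes>\<^sub>M M) V \<longrightarrow>
        Gbar2_well_defined M P \<mu> h \<and>
        Gbar2 M P \<mu> h \<in> weighted_space (M \<Otimes>\<^sub>M M) W \<and>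
        weighted_norm (M \<Otimes>\<^sub>M M) W (Gbar2 M P \<mu> h)
          \<le> ennreal c * weighted_norm (M \<Otimes>\<^sub>M M) V (hbar2 \<mu> h) \<and>
        (\<forall>x\<in>space M. \<forall>y\<in>space M.
          hbar2 \<mu> h (x, y) =
            signed_integral M (measure_diff (return M x) (P x))
              (\<lambda>z\<^sub>1. signed_integral M (measure_diff (return M y) (P y))
                 (\<lambda>z\<^sub>2. Gbar2 M P \<mu> h (z\<^sub>1, z\<^sub>2)))) \<and>
        (act1 P (hbar2 \<mu> h) \<in> weighted_space (M \<Otimes>\<^sub>M M) V \<longrightarrow>
          weighted_norm (M \<Otimes>\<^sub>M M) W (act1 P (Gbar2 M P \<mu> h))
            \<le> ennreal c * weighted_norm (M \<Otimes>\<^sub>M M) V (act1 P (hbar2 \<mu> h))) \<and>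
        (act2 P (hbar2 \<mu> h) \<in> weighted_space (M \<Otimes>\<^sub>M M) V \<longrightarrow>
          weighted_norm (M \<Otimes>\<^sub>M M) W (act2 P (Gbar2 M P \<mu> h))
            \<le> ennreal c * weighted_norm (M \<Otimes>\<^sub>M M) V (act2 P (hbar2 \<mu> h))))"
proof -
  have V1: "1 \<le> V z" and VW: "V z \<le> W z" if "z \<in> space (M \<Otimes>\<^sub>M M)" for z
    using that assms(8,9) by (auto simp: space_pair_measure)
  obtain c' where c': "\<And>x y. x \<in> space M \<Longrightarrow> y \<in> space M \<Longrightarrow>
      (\<Sum>k. \<Sum>l. signed_norm (M \<Otimes>\<^sub>M M) V (centered_pair M P \<mu> k l x y)) \<le> ennreal (c' * W (x, y))"
    using assms(10) unfolding condition_C2_def by blast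
  \<comment> \<open>The constant of condition C is fixed before \<open>h\<close> is introduced and
    serves all three bounds. A negative \<open>c'\<close> would be clipped to 0 by
    \<open>ennreal\<close>, so the maximum preserves the condition.\<close>
  define c where "c = max 0 c'"
  interpret poisson2 M \<mu> P V W c
  proof
    fix x y assume xy: "x \<in> space M" "y \<in> space M"
    then have "0 \<le> W (x, y)" using assms(8,9)[of x y] by linarith
    then have "c' * W (x, y) \<le> c * W (x, y)"
      by (intro mult_right_mono) (auto simp: c_def)
    then show "(\<Sum>k. \<Sum>l. signed_norm (M \<Otimes>\<^sub>M M) V (centered_pair M P \<mu> k l x y)) \<le> ennreal (c * W (x, y))"
      by (rule order_trans[OF c'[OF xy] ennreal_leI])
  qed (use assms V1 VW in \<open>auto simp: c_def\<close>)
  have W1: "1 \<le> W z" if "z \<in> space (M \<Otimes>\<^sub>M M)" for z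
    using V1[OF that] VW[OF that] by linarith
  show ?thesis
  proof (intro exI[of _ c] conjI c_nonneg allI impI)
    fix h :: "'a \<times> 'a \<Rightarrow> real"
    assume h: "h \<in> borel_measurable (M \<Otimes>\<^sub>M M)" "\<forall>x\<in>space M. \<forall>y\<in>space M. h (x, y) = h (y, x)"
      "(\<integral>\<^sup>+x. (\<integral>\<^sup>+y. ennreal \<bar>h (x, y)\<bar> \<partial>\<mu>) \<partial>\<mu>) < \<infinity>"
      and hb: "hbar2 \<mu> h \<in> weighted_space (M \<Otimes>\<^sub>M M) V"
    have dom: "\<exists>C. weighted_norm (M \<Otimes>\<^sub>M M) V f = ennreal C \<and> dominated f C"
      if f: "f \<in> weighted_space (M \<Otimes>\<^sub>M M) V" for f
    proof -
      obtain C where "0 \<le> C" "weighted_norm (M \<Otimes>\<^sub>M M) V f = ennreal C"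
        "\<And>z. z \<in> space (M \<Otimes>\<^sub>M M) \<Longrightarrow> \<bar>f z\<bar> \<le> C * V z"
        using weighted_space_bound[OF f V1] by blast
      then show ?thesis using f by (auto simp: dominated_def weighted_space_def)
    qed
    obtain C where C: "weighted_norm (M \<Otimes>\<^sub>M M) V (hbar2 \<mu> h) = ennreal C" "dominated (hbar2 \<mu> h) C"
      using dom[OF hb] by blast
    interpret hoeffding2_finite M \<mu> P V W c h C
    proof
      fix z a b assume "z \<in> space (M \<Otimes>\<^sub>M M)" "a \<le> (1::nat)" "b \<le> (1::nat)"
      then show "(\<integral>\<^sup>+w. ennreal (W w) \<partial>ker2 (enat a) (enat b) z) < \<infinity>"
        using assms(7,11,12) by (intro W_ker2_finite) auto
    qed (use h C in auto)
    have norm_le: "weighted_norm (M \<Otimes>\<^sub>M M) W f \<le> ennreal c * ennreal D"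
      if "0 \<le> D" "\<And>z. z \<in> space (M \<Otimes>\<^sub>M M) \<Longrightarrow> \<bar>f z\<bar> \<le> (c * D) * W z" for f D
      using that W1 c_nonneg weighted_norm_le[of "M \<Otimes>\<^sub>M M" W "c * D" f] by (simp add: ennreal_mult)
    show "Gbar2_well_defined M P \<mu> h" by (rule Gbar2_well_defined)
    show le: "weighted_norm (M \<Otimes>\<^sub>M M) W (Gbar2 M P \<mu> h)
        \<le> ennreal c * weighted_norm (M \<Otimes>\<^sub>M M) V (hbar2 \<mu> h)"
      unfolding C(1) using dominatedD(2)[OF C(2)] Gbar2_bound by (rule norm_le)
    then show "Gbar2 M P \<mu> h \<in> weighted_space (M \<Otimes>\<^sub>M M) W"
      using Gbar2_measurable
      by (auto simp: weighted_space_def C(1) ennreal_mult_less_top intro: le_less_trans)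
    show "\<forall>x\<in>space M. \<forall>y\<in>space M.
          hbar2 \<mu> h (x, y) =
            signed_integral M (measure_diff (return M x) (P x))
              (\<lambda>z\<^sub>1. signed_integral M (measure_diff (return M y) (P y))
                 (\<lambda>z\<^sub>2. Gbar2 M P \<mu> h (z\<^sub>1, z\<^sub>2)))"
      using Gbar2_poisson_equation by blast
    note hb_m = dominatedD(1)[OF C(2)]
    show "weighted_norm (M \<Otimes>\<^sub>M M) W (act1 P (Gbar2 M P \<mu> h))
        \<le> ennreal c * weighted_norm (M \<Otimes>\<^sub>M M) V (act1 P (hbar2 \<mu> h))"
      if f: "act1 P (hbar2 \<mu> h) \<in> weighted_space (M \<Otimes>\<^sub>M M) V"
    proof -
      obtain D where D: "weighted_norm (M \<Otimes>\<^sub>M M) V (act1 P (hbar2 \<mu> h)) = ennreal D"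
        "dominated (act1 P (hbar2 \<mu> h)) D"
        using dom[OF f] by blast
      have "\<bar>act1 P (Gbar2 M P \<mu> h) z\<bar> \<le> (c * D) * W z" if z: "z \<in> space (M \<Otimes>\<^sub>M M)" for z
        using T_Gbar2_bound[of 1 0, OF _ _ D(2) _ z] integrable_Gbar2[OF z, of 1 0]
        by (simp add: act_eq_T hb_m Gbar2_measurable dominated_integrable[OF C(2)] z
            zero_enat_def[symmetric] one_enat_def[symmetric] del: One_nat_def)
      with dominatedD(2)[OF D(2)] show ?thesis unfolding D(1) by (rule norm_le)
    qed
    show "weighted_norm (M \<Otimes>\<^sub>M M) W (act2 P (Gbar2 M P \<mu> h))
        \<le> ennreal c * weighted_norm (M \<Otimes>\<^sub>M M) V (act2 P (hbar2 \<mu> h))"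
      if f: "act2 P (hbar2 \<mu> h) \<in> weighted_space (M \<Otimes>\<^sub>M M) V"
    proof -
      obtain D where D: "weighted_norm (M \<Otimes>\<^sub>M M) V (act2 P (hbar2 \<mu> h)) = ennreal D"
        "dominated (act2 P (hbar2 \<mu> h)) D"
        using dom[OF f] by blast
      have "\<bar>act2 P (Gbar2 M P \<mu> h) z\<bar> \<le> (c * D) * W z" if z: "z \<in> space (M \<Otimes>\<^sub>M M)" for z
        using T_Gbar2_bound[of 1 1, OF _ _ D(2) _ z] integrable_Gbar2[OF z, of 1 1]
        by (simp add: act_eq_T hb_m Gbar2_measurable dominated_integrable[OF C(2)] z
            zero_enat_def[symmetric] one_enat_def[symmetric] del: One_nat_def)
      with dominatedD(2)[OF D(2)] show ?thesis unfolding D(1) by (rule norm_le)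
    qed
  qed
qed

end
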